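(* Let $f\in S_{\mu,L}(\mathbb{R}^d)$ with minimizer $x^*$ and $f^*=f(x^* )$, and consider the noisy accelerated gradient iterations $$y_k=(1+\beta)x_k-\beta x_{k-1},\qquad x_{k+1}=y_k-\alpha(\nabla f(y_k)+w_k),$$ with parameters $\alpha$ and $\beta$, where $\{w_k\}$ satisfies the noise assumption of the context. Let $\xi_k=[x_k^\top\;x_{k-1}^\top]^\top$ and let $A,B,X_0,X(\rho),\Phi,V_{P,c}$ be as in the context. Assume there exist $\rho\in(0,1)$, a symmetric positive semidefinite $\tilde P\in\mathbb{R}^{2\times2}$, $c_0\ge0$ and $c>0$ such that $$c_0X_0+cX(\rho)\succeq\Phi(A,B,P,\rho),\qquad P=\tilde P\otimes I_d.$$ Then for all $k\ge0$, $$\mathbb{E}[f(x_k)-f^*]\le\rho^{2k}\psi_0+(1-\rho^{2k})\,\sigma^2R_{AG}(\alpha,\beta),\qquad\psi_0=\tfrac1cV_{P,c}(\xi_0),$$ where $$R_{AG}(\alpha,\beta)=\begin{cases} \dfrac{L\alpha^2d}{2(1-\rho^2)}\cdot\dfrac{cL+2\tilde P_{11}}{cL+2(\tilde P_{11}-\tilde P_{12}^2/\tilde P_{22})}, & \tilde P_{22}>0, \\[2ex] \dfrac{L\alpha^2d}{2(1-\rho^2)}, & \tilde P_{22}=0. \end{cases}$$ As a consequence, $\mathcal{J}\le R_{AG}(\alpha,\beta)$, where $\mathcal{J}=\limsup_{k\to\infty}\frac1{\sigma^2}\mathbb{E}[f(x_k)-f^*]$.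
   Context: For $0<\mu\le L$, $S_{\mu,L}(\mathbb{R}^d)$ is the set of continuously differentiable $f:\mathbb{R}^d\to\mathbb{R}$ with $\frac L2\|x-y\|^2\ge f(x)-f(y)-\nabla f(y)^\top(x-y)\ge\frac\mu2\|x-y\|^2$ for all $x,y$. System matrices: $A=\begin{bmatrix} (1+\beta)I_d & -\beta I_d \\ I_d & 0_d \end{bmatrix}$, $B=\begin{bmatrix} -\alpha I_d \\ 0_d \end{bmatrix}$, $C=[(1+\beta)I_d\;\;-\beta I_d]$, so $\xi_{k+1}=A\xi_k+B(\nabla f(y_k)+w_k)$, $y_k=C\xi_k$. With $\xi^*=[x^{*\top}\;x^{*\top}]^\top$, $V_{P,c}(\xi_k)=(\xi_k-\xi^* )^\top P(\xi_k-\xi^* )+c(f(x_k)-f^* )$. $\Phi(A,B,P,\rho)=\begin{bmatrix} A^\top PA-\rho^2P & A^\top PB \\ B^\top PA & B^\top PB \end{bmatrix}$. $X_0=\begin{bmatrix} 2\mu L\,C^\top C & -(\mu+L)C^\top \\ -(\mu+L)C & 2I_d \end{bmatrix}$. $X(\rho)=\rho^2X_1+(1-\rho^2)X_2$ with $X_j=\tilde X_j\otimes I_d$, $$\tilde X_1=\tfrac12\begin{bmatrix} \beta^2\mu & -\beta^2\mu & -\beta \\ -\beta^2\mu & \beta^2\mu & \beta \\ -\beta & \beta & \alpha(2-L\alpha) \end{bmatrix},\quad \tilde X_2=\tfrac12\begin{bmatrix} (1+\beta)^2\mu & -\beta(1+\beta)\mu & -(1+\beta) \\ -\beta(1+\beta)\mu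 & \beta^2\mu & \beta \\ -(1+\beta) & \beta & \alpha(2-L\alpha) \end{bmatrix}.$$ Noise assumption: for some $\sigma>0$ and every $k\ge0$, the random vector $w_k\in\mathbb{R}^d$ has zero mean, is independent of $\{\xi_i\}_{i=1}^k$ and $\{y_i\}_{i=1}^k$, and $\mathbb{E}[w_kw_k^\top]=\sigma^2I_d$; $x_0,x_{-1}$ are deterministic. $\succeq$ is the positive semidefinite order. *)

theory Defs
  imports "HOL-Probability.Probability"
begin

definition grad :: "('a::real_inner \<Rightarrow> real) \<Rightarrow> 'a \<Rightarrow> 'a" where
  "grad f x = (THE D. GDERIV f x :> D)"

definition smooth_strongly_convex :: "real \<Rightarrow> real \<Rightarrow> ('a::real_inner \<Rightarrow> real) set" where
  "smooth_strongly_convex \<mu> L = {f.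
     (\<forall>x. GDERIV f x :> grad f x) \<and> continuous_on UNIV (grad f) \<and>
     (\<forall>x y. L / 2 * (norm (x - y))\<^sup>2 \<ge> f x - f y - grad f y \<bullet> (x - y) \<and>
            f x - f y - grad f y \<bullet> (x - y) \<ge> \<mu> / 2 * (norm (x - y))\<^sup>2)}"

definition psd :: "real^'n^'n \<Rightarrow> bool" where
  "psd M \<longleftrightarrow> transpose M = M \<and> (\<forall>v. v \<bullet> (M *v v) \<ge> 0)"

definition psd_ge :: "real^'n^'n \<Rightarrow> real^'n^'n \<Rightarrow> bool"  (infix \<open>\<succeq>\<close> 50) where
  "M \<succeq> N \<longleftrightarrow> psd (M - N)"

text \<open>
  A space of dimension \<open>m d\<close> is \<open>real^('m \<times> 'n)\<close> with \<open>CARD('m) = m\<close> and \<open>CARD('n) = d\<close>: the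
  index \<open>(a, i)\<close> is coordinate \<open>i\<close> of the \<open>a\<close>-th block. For \<open>'a = real\<close> the next function stacks
  vectors into a block vector, for \<open>'a = real^'k\<close> it stacks matrices into a block column.
\<close>

definition stack :: "'a^'n^'m \<Rightarrow> 'a^('m::finite \<times> 'n::finite)" where
  "stack M = (\<chi> p. M $ fst p $ snd p)"

definition beside :: "'a^'n^'k^'m \<Rightarrow> 'a^('m::finite \<times> 'n::finite)^'k" where
  "beside M = (\<chi> i q. M $ fst q $ i $ snd q)"

definition block :: "'m \<Rightarrow> 'a^('m::finite \<times> 'n::finite) \<Rightarrow> 'a^'n" where
  "block a v = (\<chi> i. v $ (a, i))"

definition four_block :: "'a^'k^'k \<Rightarrow> 'a^'l^'k \<Rightarrow> 'a^'k^'l \<Rightarrow> 'a^'l^'l \<Rightarrow> 'a^('k::finite + 'l::finite)^('k + 'l)" where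
  "four_block M11 M12 M21 M22 = (\<chi> p q. case (p, q) of
       (Inl i, Inl j) \<Rightarrow> M11 $ i $ j
     | (Inl i, Inr j) \<Rightarrow> M12 $ i $ j
     | (Inr i, Inl j) \<Rightarrow> M21 $ i $ j
     | (Inr i, Inr j) \<Rightarrow> M22 $ i $ j)"

definition kronecker :: "real^'b^'a \<Rightarrow> real^'d^'c \<Rightarrow> real^('b::finite \<times> 'd::finite)^('a::finite \<times> 'c::finite)"  (infixl \<open>\<otimes>\<^sub>K\<close> 72) where
  "M \<otimes>\<^sub>K N = (\<chi> p q. M $ fst p $ fst q * N $ snd p $ snd q)"

text \<open>
  The rows of a \<open>(2d + d) \<times> (2d + d)\<close> four-block matrix are indexed by \<open>2 \<times> 'n + 'n\<close>, those of
  \<open>X\<^sub>j = Xt\<^sub>j \<otimes>\<^sub>K I\<close> (with \<open>Xt\<^sub>j\<close> of size \<open>3 \<times> 3\<close>) by \<open>3 \<times> 'n\<close>. The following two functions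
  identify both in the given order of the rows: the two blocks of the state, then the input block.
\<close>

fun to_three_blocks :: "2 \<times> 'n + 'n \<Rightarrow> 3 \<times> 'n" where
  "to_three_blocks (Inl (a, i)) = (if a = 1 then 1 else 2, i)"
| "to_three_blocks (Inr i) = (3, i)"

definition from_three_blocks :: "'a^(3 \<times> 'n::finite)^(3 \<times> 'n) \<Rightarrow> 'a^(2 \<times> 'n + 'n)^(2 \<times> 'n + 'n)" where
  "from_three_blocks M = (\<chi> p q. M $ to_three_blocks p $ to_three_blocks q)"

definition AG_A :: "real \<Rightarrow> real^(2 \<times> 'n)^(2 \<times> 'n::finite)" where
  "AG_A \<beta> = stack (vector [beside (vector [(1 + \<beta>) *\<^sub>R mat 1, (- \<beta>) *\<^sub>R mat 1]),
                            beside (vector [mat 1, 0])])"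

definition AG_B :: "real \<Rightarrow> real^'n^(2 \<times> 'n::finite)" where
  "AG_B \<alpha> = stack (vector [(- \<alpha>) *\<^sub>R mat 1, 0])"

definition AG_C :: "real \<Rightarrow> real^(2 \<times> 'n)^'n::finite" where
  "AG_C \<beta> = beside (vector [(1 + \<beta>) *\<^sub>R mat 1, (- \<beta>) *\<^sub>R mat 1])"

definition Phi :: "real^'k^'k \<Rightarrow> real^'l^'k \<Rightarrow> real^'k^'k \<Rightarrow> real \<Rightarrow> real^('k::finite + 'l::finite)^('k + 'l)" where
  "Phi A B P \<rho> = four_block
     (transpose A ** P ** A - \<rho>\<^sup>2 *\<^sub>R P)  (transpose A ** P ** B)
     (transpose B ** P ** A)              (transpose B ** P ** B)"

definition X0 :: "real \<Rightarrow> real \<Rightarrow> real \<Rightarrow> real^(2 \<times> 'n + 'n)^(2 \<times> 'n + 'n::finite)" where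
  "X0 \<mu> L \<beta> = four_block
     ((2 * \<mu> * L) *\<^sub>R (transpose (AG_C \<beta>) ** AG_C \<beta>))  (- (\<mu> + L) *\<^sub>R transpose (AG_C \<beta>))
     (- (\<mu> + L) *\<^sub>R AG_C \<beta>)                             (2 *\<^sub>R mat 1)"

definition X1_tilde :: "real \<Rightarrow> real \<Rightarrow> real \<Rightarrow> real \<Rightarrow> real^3^3" where
  "X1_tilde \<mu> L \<alpha> \<beta> = (1/2) *\<^sub>R vector [
     vector [\<beta>\<^sup>2 * \<mu>,      - (\<beta>\<^sup>2 * \<mu>),  - \<beta>],
     vector [- (\<beta>\<^sup>2 * \<mu>),  \<beta>\<^sup>2 * \<mu>,      \<beta>],
     vector [- \<beta>,          \<beta>,          \<alpha> * (2 - L * \<alpha>)]]"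

definition X2_tilde :: "real \<Rightarrow> real \<Rightarrow> real \<Rightarrow> real \<Rightarrow> real^3^3" where
  "X2_tilde \<mu> L \<alpha> \<beta> = (1/2) *\<^sub>R vector [
     vector [(1 + \<beta>)\<^sup>2 * \<mu>,          - (\<beta> * (1 + \<beta>) * \<mu>),  - (1 + \<beta>)],
     vector [- (\<beta> * (1 + \<beta>) * \<mu>),  \<beta>\<^sup>2 * \<mu>,              \<beta>],
     vector [- (1 + \<beta>),              \<beta>,                  \<alpha> * (2 - L * \<alpha>)]]"

definition X_rho ::
  "real \<Rightarrow> real \<Rightarrow> real \<Rightarrow> real \<Rightarrow> real \<Rightarrow> real^(2 \<times> 'n + 'n)^(2 \<times> 'n + 'n::finite)" where
  "X_rho \<mu> L \<alpha> \<beta> \<rho> =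
     \<rho>\<^sup>2 *\<^sub>R from_three_blocks (X1_tilde \<mu> L \<alpha> \<beta> \<otimes>\<^sub>K (mat 1 :: real^'n^'n)) +
     (1 - \<rho>\<^sup>2) *\<^sub>R from_three_blocks (X2_tilde \<mu> L \<alpha> \<beta> \<otimes>\<^sub>K (mat 1 :: real^'n^'n))"

definition Lyap ::
  "(real^'n \<Rightarrow> real) \<Rightarrow> real^'n \<Rightarrow> real^(2 \<times> 'n)^(2 \<times> 'n) \<Rightarrow> real \<Rightarrow> real^(2 \<times> 'n::finite) \<Rightarrow> real" where
  "Lyap f xs P c \<xi> =
     (let \<xi>s = stack (vector [xs, xs])
      in (\<xi> - \<xi>s) \<bullet> (P *v (\<xi> - \<xi>s)) + c * (f (block 1 \<xi>) - f xs))"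

definition outer :: "real^'n \<Rightarrow> real^'n^'n" where
  "outer v = (\<chi> i j. v $ i * v $ j)"

text \<open>
  The constant \<open>indep_var\<close> needs both random variables to have the same value type; this is the same
  notion (compare \<open>indep_var_eq\<close>) for a random vector and a family of random vectors: the two
  generated \<open>\<sigma>\<close>-algebras are independent.
\<close>

definition indep_of_family ::
  "'w measure \<Rightarrow> ('w \<Rightarrow> 'a::topological_space) \<Rightarrow> ('i \<Rightarrow> 'w \<Rightarrow> 'b::topological_space) \<Rightarrow> 'i set \<Rightarrow> bool"
where
  "indep_of_family M w Z I \<longleftrightarrow>
     w \<in> borel_measurable M \<and> (\<forall>i\<in>I. Z i \<in> borel_measurable M) \<and>
     prob_space.indep_set M
       (sigma_sets (space M) {w -` S \<inter> space M | S. S \<in> sets borel})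
       (sigma_sets (space M) (\<Union>i\<in>I. {Z i -` S \<inter> space M | S. S \<in> sets borel}))"

definition noise_assumption ::
  "'w measure \<Rightarrow> real \<Rightarrow> (nat \<Rightarrow> 'w \<Rightarrow> real^(2 \<times> 'n)) \<Rightarrow> (nat \<Rightarrow> 'w \<Rightarrow> real^'n) \<Rightarrow>
   (nat \<Rightarrow> 'w \<Rightarrow> real^'n::finite) \<Rightarrow> bool" where
  "noise_assumption M \<sigma> \<xi> y w \<longleftrightarrow> \<sigma> > 0 \<and>
     (\<forall>k. has_bochner_integral M (w k) 0 \<and>
          has_bochner_integral M (\<lambda>\<omega>. outer (w k \<omega>)) (\<sigma>\<^sup>2 *\<^sub>R mat 1) \<and>
          indep_of_family M (w k) \<xi> {1..k} \<and>
          indep_of_family M (w k) y {1..k})"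

definition R_AG :: "real \<Rightarrow> nat \<Rightarrow> real \<Rightarrow> real^2^2 \<Rightarrow> real \<Rightarrow> real \<Rightarrow> real" where
  "R_AG L d \<rho> Pt c \<alpha> =
     (if Pt $ 2 $ 2 > 0 then
        L * \<alpha>\<^sup>2 * real d / (2 * (1 - \<rho>\<^sup>2)) *
        ((c * L + 2 * Pt $ 1 $ 1) /
         (c * L + 2 * (Pt $ 1 $ 1 - (Pt $ 1 $ 2)\<^sup>2 / Pt $ 2 $ 2)))
      else L * \<alpha>\<^sup>2 * real d / (2 * (1 - \<rho>\<^sup>2)))"

end

theory Submission
  imports Defs
begin

text \<open>
  Along the iteration the Lyapunov function contracts in expectation up to a noise term,
  \<open>E V (k + 1) \<le> \<rho>\<^sup>2 * E V k + N\<close>. Evaluating the matrix inequality at the stacked vector of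
  state error and gradient \<open>u\<close> gives the contraction of the noiseless part: \<open>X0\<close> contributes a
  nonpositive quantity by cocoercivity of the gradient, while \<open>X (\<rho>)\<close> encodes the descent lemma at
  \<open>y k\<close> combined with the strong convexity bounds of \<open>f (y k)\<close> by \<open>f (x k)\<close> and \<open>f xs\<close>. The noise
  enters linearly, where it vanishes in expectation by independence, and through \<open>(norm w)\<^sup>2\<close>, with
  expectation \<open>\<sigma>\<^sup>2 d\<close>. Independence of \<open>w k\<close> from the states and from the \<open>y\<close>'s separately is
  enough because the linear term splits into a function of \<open>x k\<close> and a function of \<open>y k\<close>.

  Bounding the quadratic part of \<open>V\<close> below by the Schur complement of \<open>Pt\<close> and using
  \<open>f x - f xs \<le> L/2 * (norm (x - xs))\<^sup>2\<close> gives \<open>V \<ge> (c + 2 * s / L) * (f x - f xs)\<close>, where \<open>s\<close> is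
  that complement; this is the source of the denominator of \<open>R_AG\<close>.
\<close>

section \<open>Inequalities for smooth strongly convex functions\<close>

lemma smooth_strongly_convexD:
  assumes "f \<in> smooth_strongly_convex \<mu> L"
  shows "f x \<le> f y + grad f y \<bullet> (x - y) + L / 2 * (norm (x - y))\<^sup>2"
    and "f y + grad f y \<bullet> (x - y) + \<mu> / 2 * (norm (x - y))\<^sup>2 \<le> f x"
    and "continuous_on UNIV (grad f)"
proof -
  have *: "f x - f y - grad f y \<bullet> (x - y) \<le> L / 2 * (norm (x - y))\<^sup>2"
      "\<mu> / 2 * (norm (x - y))\<^sup>2 \<le> f x - f y - grad f y \<bullet> (x - y)"
    using assms unfolding smooth_strongly_convex_def by blast+
  show "f x \<le> f y + grad f y \<bullet> (x - y) + L / 2 * (norm (x - y))\<^sup>2"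
    using *(1) by linarith
  show "f y + grad f y \<bullet> (x - y) + \<mu> / 2 * (norm (x - y))\<^sup>2 \<le> f x"
    using *(2) by linarith
  show "continuous_on UNIV (grad f)"
    using assms unfolding smooth_strongly_convex_def by blast
qed

lemma smooth_strongly_convex_continuous:
  assumes "f \<in> smooth_strongly_convex \<mu> L"
  shows "continuous_on UNIV f"
  using assms unfolding smooth_strongly_convex_def gderiv_def
  by (auto intro!: continuous_at_imp_continuous_on has_derivative_continuous)

text \<open>A gradient step of length \<open>1/L\<close> from \<open>xs\<close> lowers
  \<open>f\<close> by at least \<open>(?g \<bullet> ?g) / (2 * L)\<close>, which minimality allows
  only for a zero gradient.\<close>

lemma grad_minimizer_eq_0:
  assumes f: "f \<in> smooth_strongly_convex \<mu> L" and "0 < L" and min: "\<And>z. f xs \<le> f z"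
  shows "grad f xs = 0"
proof -
  let ?g = "grad f xs"
  have "f (xs - (1/L) *\<^sub>R ?g) \<le> f xs + ?g \<bullet> (- (1/L) *\<^sub>R ?g) + L/2 * (norm (- (1/L) *\<^sub>R ?g))\<^sup>2"
    using smooth_strongly_convexD(1)[OF f, of "xs - (1/L) *\<^sub>R ?g" xs] by simp
  also have "\<dots> = f xs - (1 / (2 * L)) * (?g \<bullet> ?g)"
    using \<open>0 < L\<close> by (simp add: dot_square_norm power2_eq_square field_simps)
  finally have "(1 / (2 * L)) * (?g \<bullet> ?g) \<le> 0"
    using min[of "xs - (1/L) *\<^sub>R ?g"] by linarith
  then have "?g \<bullet> ?g \<le> 0"
    using \<open>0 < L\<close> by (simp add: divide_le_0_iff)
  then show ?thesis by (metis inner_ge_zero inner_eq_zero_iff order_antisym)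
qed

text \<open>With \<open>h\<close> the gradient difference of \<open>f\<close> after subtracting
  \<open>\<mu>/2\<close> times the squared norm, this is the cocoercivity
  \<open>h \<bullet> h \<le> (L - \<mu>) * (h \<bullet> D)\<close> rewritten in terms of
  \<open>U\<close> and \<open>D\<close>. At \<open>x = xs\<close> it gives the sign of the quadratic
  form of \<open>X0\<close>.\<close>

lemma smooth_strongly_convex_interpolation:
  assumes f: "f \<in> smooth_strongly_convex \<mu> L" and "\<mu> \<le> L"
  shows "\<mu> * L * ((y - x) \<bullet> (y - x)) - (\<mu> + L) * ((y - x) \<bullet> (grad f y - grad f x))
    + (grad f y - grad f x) \<bullet> (grad f y - grad f x) \<le> 0"
proof -
  define D where "D = y - x"
  define U where "U = grad f y - grad f x"
  define h where "h = U - \<mu> *\<^sub>R D"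
  \<comment> \<open>The upper bound at one point dominates the lower bound at the other, both at
    \<open>y - t h\<close> and at \<open>x + t h\<close>; add the two. Keeping \<open>t\<close> free covers \<open>L = \<mu>\<close> as well.\<close>
  have key: "(2 * t - (L - \<mu>) * t\<^sup>2) * (h \<bullet> h) \<le> h \<bullet> D" for t
  proof -
    have y: "y = x + D" and gy: "grad f y = grad f x + U" and U: "U = h + \<mu> *\<^sub>R D"
      by (auto simp: D_def U_def h_def)
    have "f x + grad f x \<bullet> (y - t *\<^sub>R h - x) + \<mu> / 2 * (norm (y - t *\<^sub>R h - x))\<^sup>2
        \<le> f y + grad f y \<bullet> (y - t *\<^sub>R h - y) + L / 2 * (norm (y - t *\<^sub>R h - y))\<^sup>2"
      by (rule order_trans[OF smooth_strongly_convexD(2)[OF f] smooth_strongly_convexD(1)[OF f]])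
    moreover have "f y + grad f y \<bullet> (x + t *\<^sub>R h - y) + \<mu> / 2 * (norm (x + t *\<^sub>R h - y))\<^sup>2
        \<le> f x + grad f x \<bullet> (x + t *\<^sub>R h - x) + L / 2 * (norm (x + t *\<^sub>R h - x))\<^sup>2"
      by (rule order_trans[OF smooth_strongly_convexD(2)[OF f] smooth_strongly_convexD(1)[OF f]])
    ultimately show ?thesis
      unfolding gy unfolding y U power2_norm_eq_inner
      by (simp add: inner_add_left inner_add_right inner_diff_left inner_diff_right inner_commute
          power2_eq_square algebra_simps)
  qed
  have "h \<bullet> h \<le> (L - \<mu>) * (h \<bullet> D)"
  proof (cases "L = \<mu>")
    case True
    have "h \<bullet> h = 0"
    proof (rule ccontr)
      assume nz: "h \<bullet> h \<noteq> 0"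
      \<comment> \<open>For \<open>L = \<mu>\<close> the left side of \<open>key\<close> is linear
        in \<open>t\<close>; this \<open>t\<close> makes it
        \<open>h \<bullet> D + 1\<close>.\<close>
      show False
        using key[of "(h \<bullet> D + 1) / (2 * (h \<bullet> h))"] nz True by simp
    qed
    then show ?thesis using True by simp
  next
    case False
    then have "0 < L - \<mu>" using \<open>\<mu> \<le> L\<close> by simp
    \<comment> \<open>The maximizer of \<open>2 * t - (L - \<mu>) * t\<^sup>2\<close> is
      \<open>t = 1 / (L - \<mu>)\<close>, with value \<open>1 / (L - \<mu>)\<close>.\<close>
    have "(1 / (L - \<mu>)) * (h \<bullet> h) \<le> h \<bullet> D"
      using key[of "1 / (L - \<mu>)"] \<open>0 < L - \<mu>\<close> by (simp add: power2_eq_square)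
    then show ?thesis using \<open>0 < L - \<mu>\<close> by (simp add: field_simps)
  qed
  then show ?thesis
    unfolding D_def[symmetric] U_def[symmetric]
    by (simp add: h_def inner_diff_left inner_diff_right inner_commute algebra_simps)
qed

text \<open>Dropping the nonnegative \<open>\<mu> * L\<close> term from the interpolation inequality
  and applying Cauchy-Schwarz gives the constant \<open>\<mu> + L\<close>. Linear growth with any
  constant is enough for its use, the square integrability of gradients.\<close>

lemma norm_grad_le:
  assumes f: "f \<in> smooth_strongly_convex \<mu> L" and "0 < \<mu>" "\<mu> \<le> L" and "grad f xs = 0"
  shows "norm (grad f y) \<le> (\<mu> + L) * norm (y - xs)"
proof -
  have "0 \<le> \<mu> * L * ((y - xs) \<bullet> (y - xs))"
    using assms by simp
  then have "norm (grad f y) * norm (grad f y) \<le> (\<mu> + L) * ((y - xs) \<bullet> grad f y)"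
    using smooth_strongly_convex_interpolation[OF f \<open>\<mu> \<le> L\<close>, where x = xs and y = y]
    unfolding \<open>grad f xs = 0\<close> diff_zero dot_square_norm[of "grad f y"] power2_eq_square
    by linarith
  also have "\<dots> \<le> (\<mu> + L) * (norm (y - xs) * norm (grad f y))"
    using assms by (intro mult_left_mono norm_cauchy_schwarz) auto
  finally have "norm (grad f y) * norm (grad f y) \<le> ((\<mu> + L) * norm (y - xs)) * norm (grad f y)"
    by (simp add: mult_ac)
  then show ?thesis
    using assms by (cases "grad f y = 0") auto
qed

section \<open>Block vectors, system matrices and their quadratic forms\<close>

lemma sum_two_blocks:
  fixes g :: "2 \<times> 'n::finite \<Rightarrow> 'a::comm_monoid_add"
  shows "(\<Sum>p\<in>UNIV. g p) = (\<Sum>i\<in>UNIV. g (1, i)) + (\<Sum>i\<in>UNIV. g (2, i))"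
  by (simp add: UNIV_Times_UNIV[symmetric] sum.cartesian_product' UNIV_2 del: UNIV_Times_UNIV)

lemma stack_vector_2_nth [simp]:
  "stack (vector [a, b] :: 'a::zero^'n::finite^2) $ (1, i) = a $ i"
  "stack (vector [a, b] :: 'a::zero^'n::finite^2) $ (2, i) = b $ i"
  by (simp_all add: stack_def)

lemma block_stack_vector_2 [simp]:
  "block 1 (stack (vector [a, b] :: 'a::zero^'n::finite^2)) = a"
  "block 2 (stack (vector [a, b] :: 'a::zero^'n::finite^2)) = b"
  by (simp_all add: block_def vec_eq_iff)

lemma two_blocks_eq_iff:
  fixes v v' :: "'a^(2 \<times> 'n::finite)"
  shows "v = v' \<longleftrightarrow> (\<forall>i. v $ (1, i) = v' $ (1, i)) \<and> (\<forall>i. v $ (2, i) = v' $ (2, i))"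
  unfolding vec_eq_iff split_paired_All forall_2 by (rule refl)

lemma stack_vector_2_diff:
  fixes a b c d :: "real^'n::finite"
  shows "stack (vector [a, b] :: (real^'n)^2) - stack (vector [c, d]) = stack (vector [a - c, b - d])"
  by (simp add: two_blocks_eq_iff)

lemma stack_vector_2_add:
  fixes a b c d :: "real^'n::finite"
  shows "stack (vector [a, b] :: (real^'n)^2) + stack (vector [c, d]) = stack (vector [a + c, b + d])"
  by (simp add: two_blocks_eq_iff)

lemma inner_stack_vector_2:
  fixes a b c d :: "real^'n::finite"
  shows "stack (vector [a, b] :: (real^'n)^2) \<bullet> stack (vector [c, d]) = a \<bullet> c + b \<bullet> d"
  by (simp add: inner_vec_def sum_two_blocks)

lemma sum_mat_1: "(\<Sum>j\<in>UNIV. k * (mat 1 :: real^'n^'n) $ i $ j * g j) = k * g (i::'n::finite)"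
  "(\<Sum>j\<in>UNIV. (mat 1 :: real^'n^'n) $ i $ j * g j) = g (i::'n::finite)"
  by (simp_all add: mat_def if_distrib[of "\<lambda>x. _ * x"] if_distrib[of "\<lambda>x. x * _"] cong: if_cong)

lemma kronecker_mult_stack:
  fixes Pt :: "real^2^2" and a b :: "real^'n::finite"
  shows "(Pt \<otimes>\<^sub>K (mat 1 :: real^'n^'n)) *v stack (vector [a, b]) =
    stack (vector [Pt $ 1 $ 1 *\<^sub>R a + Pt $ 1 $ 2 *\<^sub>R b, Pt $ 2 $ 1 *\<^sub>R a + Pt $ 2 $ 2 *\<^sub>R b])"
  by (simp add: two_blocks_eq_iff matrix_vector_mult_def sum_two_blocks kronecker_def sum_mat_1)

lemma AG_A_mult_stack:
  "AG_A \<beta> *v stack (vector [a, b]) = stack (vector [(1 + \<beta>) *\<^sub>R a - \<beta> *\<^sub>R b, a])"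
  by (simp add: two_blocks_eq_iff matrix_vector_mult_def sum_two_blocks AG_A_def beside_def
      sum_mat_1 sum_negf)

lemma AG_B_mult: "AG_B \<alpha> *v u = stack (vector [- \<alpha> *\<^sub>R u, 0])"
  by (simp add: two_blocks_eq_iff matrix_vector_mult_def AG_B_def sum_mat_1 sum_negf)

lemma AG_C_mult_stack:
  "AG_C \<beta> *v stack (vector [a, b]) = (1 + \<beta>) *\<^sub>R a - \<beta> *\<^sub>R b"
  by (simp add: vec_eq_iff matrix_vector_mult_def sum_two_blocks AG_C_def beside_def
      sum_mat_1 sum_negf)

definition append_vec :: "'a^'k \<Rightarrow> 'a^'l \<Rightarrow> 'a^('k::finite + 'l::finite)" where
  "append_vec v u = (\<chi> p. case p of Inl i \<Rightarrow> v $ i | Inr j \<Rightarrow> u $ j)"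

lemma sum_Inl_Inr:
  fixes g :: "'k::finite + 'l::finite \<Rightarrow> 'a::comm_monoid_add"
  shows "(\<Sum>p\<in>UNIV. g p) = (\<Sum>i\<in>UNIV. g (Inl i)) + (\<Sum>j\<in>UNIV. g (Inr j))"
  by (simp add: UNIV_Plus_UNIV[symmetric] sum.Plus del: UNIV_Plus_UNIV)

lemma four_block_quadratic:
  fixes v :: "real^'k::finite" and u :: "real^'l::finite"
  shows "append_vec v u \<bullet> (four_block M11 M12 M21 M22 *v append_vec v u) =
    v \<bullet> (M11 *v v) + v \<bullet> (M12 *v u) + u \<bullet> (M21 *v v) + u \<bullet> (M22 *v u)"
  by (simp add: inner_vec_def matrix_vector_mult_def four_block_def append_vec_def sum_Inl_Inr
      sum.distrib distrib_left)

lemma inner_vector_matrix_mult: "v \<bullet> (u v* N) = (N *v v) \<bullet> (u::real^'n::finite)"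
  by (metis dot_lmul_matrix inner_commute)

text \<open>The four blocks are those of \<open>P\<close> conjugated by the block row of
  \<open>A\<close> and \<open>B\<close>, with \<open>\<rho>\<^sup>2 *\<^sub>R P\<close> subtracted
  on the state part. So the form compares the noiseless next state with the current one.\<close>

lemma Phi_quadratic:
  "append_vec v u \<bullet> (Phi A B P \<rho> *v append_vec v u) =
    (A *v v + B *v u) \<bullet> (P *v (A *v v + B *v u)) - \<rho>\<^sup>2 * (v \<bullet> (P *v v))"
  unfolding Phi_def four_block_quadratic
  by (simp add: matrix_vector_mul_assoc[symmetric] inner_vector_matrix_mult matrix_vector_right_distrib
      matrix_vector_mult_diff_rdistrib inner_add_left inner_add_right inner_diff_right
      scaleR_matrix_vector_assoc[symmetric])

text \<open>For a state error \<open>v\<close>, \<open>AG_C \<beta> *v v\<close> is the error of the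
  extrapolated point; the right side is then twice the left side of
  \<open>smooth_strongly_convex_interpolation\<close> at the minimizer.\<close>

lemma X0_quadratic:
  fixes v :: "real^(2 \<times> 'n::finite)"
  shows "append_vec v u \<bullet> (X0 \<mu> L \<beta> *v append_vec v u) =
    2 * (\<mu> * L * ((AG_C \<beta> *v v) \<bullet> (AG_C \<beta> *v v)) - (\<mu> + L) * ((AG_C \<beta> *v v) \<bullet> u) + u \<bullet> u)"
  unfolding X0_def four_block_quadratic scaleR_matrix_vector_assoc[symmetric]
    matrix_vector_mul_assoc[symmetric] transpose_matrix_vector inner_scaleR_right
    inner_vector_matrix_mult matrix_vector_mul_lid
  by (simp add: inner_commute algebra_simps)

text \<open>The identity factor collapses each sum over coordinates to the coordinate of the row, so
  the \<open>3 \<times> 3\<close> factor alone mixes the blocks \<open>a\<close>, \<open>b\<close>,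
  \<open>u\<close>.\<close>

lemma three_blocks_mult:
  fixes a b u :: "real^'n::finite"
  shows "from_three_blocks (X \<otimes>\<^sub>K (mat 1 :: real^'n^'n)) *v append_vec (stack (vector [a, b])) u =
    append_vec
      (stack (vector [X $ 1 $ 1 *\<^sub>R a + X $ 1 $ 2 *\<^sub>R b + X $ 1 $ 3 *\<^sub>R u,
                      X $ 2 $ 1 *\<^sub>R a + X $ 2 $ 2 *\<^sub>R b + X $ 2 $ 3 *\<^sub>R u]))
      (X $ 3 $ 1 *\<^sub>R a + X $ 3 $ 2 *\<^sub>R b + X $ 3 $ 3 *\<^sub>R u)" (is "?l = ?r")
proof (rule vec_eq_iff[THEN iffD2, rule_format])
  fix p :: "2 \<times> 'n + 'n"
  have *: "?l $ p = X $ fst (to_three_blocks p) $ 1 * a $ snd (to_three_blocks p)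
    + X $ fst (to_three_blocks p) $ 2 * b $ snd (to_three_blocks p)
    + X $ fst (to_three_blocks p) $ 3 * u $ snd (to_three_blocks p)"
    by (simp add: matrix_vector_mult_def append_vec_def sum_Inl_Inr sum_two_blocks
        from_three_blocks_def kronecker_def sum_mat_1)
  consider i where "p = Inl (1, i)" | i where "p = Inl (2, i)" | i where "p = Inr i"
    by (cases p) (auto, metis exhaust_2)
  then show "?l $ p = ?r $ p"
    unfolding * by cases (simp_all add: append_vec_def)
qed

lemma inner_append_vec:
  fixes v v' :: "real^'k::finite" and u u' :: "real^'l::finite"
  shows "append_vec v u \<bullet> append_vec v' u' = v \<bullet> v' + u \<bullet> u'"
  by (simp add: inner_vec_def append_vec_def sum_Inl_Inr)

lemma three_blocks_quadratic:
  fixes a b u :: "real^'n::finite"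
  shows "append_vec (stack (vector [a, b])) u \<bullet>
     (from_three_blocks (X \<otimes>\<^sub>K (mat 1 :: real^'n^'n)) *v append_vec (stack (vector [a, b])) u) =
     X $ 1 $ 1 * (a \<bullet> a) + X $ 1 $ 2 * (a \<bullet> b) + X $ 1 $ 3 * (a \<bullet> u) +
     X $ 2 $ 1 * (b \<bullet> a) + X $ 2 $ 2 * (b \<bullet> b) + X $ 2 $ 3 * (b \<bullet> u) +
     X $ 3 $ 1 * (u \<bullet> a) + X $ 3 $ 2 * (u \<bullet> b) + X $ 3 $ 3 * (u \<bullet> u)"
  by (simp add: three_blocks_mult inner_append_vec inner_stack_vector_2 inner_add_right)

lemma kronecker_quadratic:
  fixes Pt :: "real^2^2" and a b :: "real^'n::finite"
  shows "stack (vector [a, b]) \<bullet> ((Pt \<otimes>\<^sub>K (mat 1 :: real^'n^'n)) *v stack (vector [a, b])) =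
    Pt $ 1 $ 1 * (a \<bullet> a) + (Pt $ 1 $ 2 + Pt $ 2 $ 1) * (a \<bullet> b) + Pt $ 2 $ 2 * (b \<bullet> b)"
  by (simp add: kronecker_mult_stack inner_stack_vector_2 inner_add_right inner_commute algebra_simps)

lemma Lyap_stack:
  fixes Pt :: "real^2^2" and a b :: "real^'n::finite"
  shows "Lyap f xs (Pt \<otimes>\<^sub>K (mat 1 :: real^'n^'n)) c (stack (vector [a, b])) =
    Pt $ 1 $ 1 * ((a - xs) \<bullet> (a - xs)) + (Pt $ 1 $ 2 + Pt $ 2 $ 1) * ((a - xs) \<bullet> (b - xs))
      + Pt $ 2 $ 2 * ((b - xs) \<bullet> (b - xs)) + c * (f a - f xs)"
  by (simp add: Lyap_def stack_vector_2_diff kronecker_quadratic)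

section \<open>The matrix inequality and one step of the iteration\<close>

text \<open>For \<open>a = x - xs\<close>, \<open>b = xm - xs\<close> and \<open>y\<close> the
  extrapolated point, \<open>e\<close> is \<open>y - xs\<close> and
  \<open>\<beta> *\<^sub>R (b - a)\<close> is \<open>x - y\<close>. The terms weighted by
  \<open>\<rho>\<^sup>2\<close> and \<open>1 - \<rho>\<^sup>2\<close> are then the strong convexity
  lower bounds of \<open>f x - f y\<close> and \<open>f xs - f y\<close>; the last term, common to
  both forms, is the decrease of a noiseless gradient step.\<close>

lemma AG_matrix_inequality_quadratic:
  fixes a b u :: "real^'n::finite" and Pt :: "real^2^2"
  assumes "c\<^sub>0 *\<^sub>R X0 \<mu> L \<beta> + c *\<^sub>R X_rho \<mu> L \<alpha> \<beta> \<rho>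
    \<succeq> Phi (AG_A \<beta>) (AG_B \<alpha>) (Pt \<otimes>\<^sub>K (mat 1 :: real^'n^'n)) \<rho>"
  defines "q \<equiv> \<lambda>a b. Pt $ 1 $ 1 * (a \<bullet> a) + (Pt $ 1 $ 2 + Pt $ 2 $ 1) * (a \<bullet> b) + Pt $ 2 $ 2 * (b \<bullet> b)"
  defines "e \<equiv> (1 + \<beta>) *\<^sub>R a - \<beta> *\<^sub>R b"
  shows "q (e - \<alpha> *\<^sub>R u) a - \<rho>\<^sup>2 * q a b \<le>
    2 * c\<^sub>0 * (\<mu> * L * (e \<bullet> e) - (\<mu> + L) * (e \<bullet> u) + u \<bullet> u)
    + c * (\<rho>\<^sup>2 * (\<mu> / 2 * ((\<beta> *\<^sub>R (b - a)) \<bullet> (\<beta> *\<^sub>R (b - a))) + u \<bullet> (\<beta> *\<^sub>R (b - a)))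
           + (1 - \<rho>\<^sup>2) * (\<mu> / 2 * (e \<bullet> e) - u \<bullet> e)
           + (\<alpha> - L * \<alpha>\<^sup>2 / 2) * (u \<bullet> u))"
proof -
  let ?v = "stack (vector [a, b]) :: real^(2 \<times> 'n)"
  let ?z = "append_vec ?v u"
  have "?z \<bullet> (Phi (AG_A \<beta>) (AG_B \<alpha>) (Pt \<otimes>\<^sub>K (mat 1 :: real^'n^'n)) \<rho> *v ?z)
      \<le> c\<^sub>0 * (?z \<bullet> (X0 \<mu> L \<beta> *v ?z)) + c * (?z \<bullet> (X_rho \<mu> L \<alpha> \<beta> \<rho> *v ?z))"
  proof -
    have "0 \<le> ?z \<bullet> ((c\<^sub>0 *\<^sub>R X0 \<mu> L \<beta> + c *\<^sub>R X_rho \<mu> L \<alpha> \<beta> \<rho>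
        - Phi (AG_A \<beta>) (AG_B \<alpha>) (Pt \<otimes>\<^sub>K (mat 1 :: real^'n^'n)) \<rho>) *v ?z)"
      using assms(1) unfolding psd_ge_def psd_def by blast
    then show ?thesis
      by (simp add: matrix_vector_mult_diff_rdistrib matrix_vector_mult_add_rdistrib
          inner_diff_right inner_add_right scaleR_matrix_vector_assoc[symmetric])
  qed
  moreover have "?z \<bullet> (Phi (AG_A \<beta>) (AG_B \<alpha>) (Pt \<otimes>\<^sub>K (mat 1 :: real^'n^'n)) \<rho> *v ?z) =
      q (e - \<alpha> *\<^sub>R u) a - \<rho>\<^sup>2 * q a b"
    by (simp add: Phi_quadratic AG_A_mult_stack AG_B_mult stack_vector_2_add kronecker_quadratic
        q_def e_def)
  moreover have "?z \<bullet> (X0 \<mu> L \<beta> *v ?z) = 2 * (\<mu> * L * (e \<bullet> e) - (\<mu> + L) * (e \<bullet> u) + u \<bullet> u)"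
    by (simp add: X0_quadratic AG_C_mult_stack e_def)
  moreover have "?z \<bullet> (X_rho \<mu> L \<alpha> \<beta> \<rho> *v ?z) =
      \<rho>\<^sup>2 * (\<mu> / 2 * ((\<beta> *\<^sub>R (b - a)) \<bullet> (\<beta> *\<^sub>R (b - a))) + u \<bullet> (\<beta> *\<^sub>R (b - a)))
      + (1 - \<rho>\<^sup>2) * (\<mu> / 2 * (e \<bullet> e) - u \<bullet> e) + (\<alpha> - L * \<alpha>\<^sup>2 / 2) * (u \<bullet> u)"
  proof -
    have *: "?z \<bullet> (X_rho \<mu> L \<alpha> \<beta> \<rho> *v ?z) =
       \<rho>\<^sup>2 * (?z \<bullet> (from_three_blocks (X1_tilde \<mu> L \<alpha> \<beta> \<otimes>\<^sub>K (mat 1 :: real^'n^'n)) *v ?z)) +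
       (1 - \<rho>\<^sup>2) * (?z \<bullet> (from_three_blocks (X2_tilde \<mu> L \<alpha> \<beta> \<otimes>\<^sub>K (mat 1 :: real^'n^'n)) *v ?z))"
      by (simp add: X_rho_def matrix_vector_mult_add_rdistrib inner_add_right
          scaleR_matrix_vector_assoc[symmetric])
    have X1: "?z \<bullet> (from_three_blocks (X1_tilde \<mu> L \<alpha> \<beta> \<otimes>\<^sub>K (mat 1 :: real^'n^'n)) *v ?z) =
      \<mu> / 2 * ((\<beta> *\<^sub>R (b - a)) \<bullet> (\<beta> *\<^sub>R (b - a))) + u \<bullet> (\<beta> *\<^sub>R (b - a))
      + (\<alpha> - L * \<alpha>\<^sup>2 / 2) * (u \<bullet> u)"
      unfolding three_blocks_quadratic
      by (simp add: X1_tilde_def vector_3 inner_diff_left inner_diff_right inner_commute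
          power2_eq_square algebra_simps)
    have X2: "?z \<bullet> (from_three_blocks (X2_tilde \<mu> L \<alpha> \<beta> \<otimes>\<^sub>K (mat 1 :: real^'n^'n)) *v ?z) =
      \<mu> / 2 * (e \<bullet> e) - u \<bullet> e + (\<alpha> - L * \<alpha>\<^sup>2 / 2) * (u \<bullet> u)"
      unfolding three_blocks_quadratic
      by (simp add: X2_tilde_def vector_3 e_def inner_diff_left inner_diff_right inner_add_left inner_add_right
          inner_commute power2_eq_square field_simps)
    show ?thesis unfolding * X1 X2 by (simp add: field_simps)
  qed
  ultimately show ?thesis by (simp add: mult_ac)
qed

text \<open>In the coefficients of the noise, the entries of \<open>Pt\<close> come from expanding
  the quadratic form at the perturbed state, and
  \<open>c * (L * \<alpha>\<^sup>2 - \<alpha>)\<close> and \<open>c * L / 2\<close> from the descent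
  inequality with step \<open>u + w\<close>. The first pairing with \<open>w\<close> involves
  \<open>x\<close> alone, the second \<open>y\<close> alone.\<close>

lemma Lyap_AG_step:
  fixes x xm xs w :: "real^'n::finite" and Pt :: "real^2^2"
  assumes f: "f \<in> smooth_strongly_convex \<mu> L" and "\<mu> \<le> L" and crit: "grad f xs = 0"
    and "0 \<le> c\<^sub>0" "0 \<le> c" "\<bar>\<rho>\<bar> \<le> 1"
    and P: "P = Pt \<otimes>\<^sub>K (mat 1 :: real^'n^'n)"
    and LMI: "c\<^sub>0 *\<^sub>R X0 \<mu> L \<beta> + c *\<^sub>R X_rho \<mu> L \<alpha> \<beta> \<rho> \<succeq> Phi (AG_A \<beta>) (AG_B \<alpha>) P \<rho>"
    and y: "y = (1 + \<beta>) *\<^sub>R x - \<beta> *\<^sub>R xm"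
  shows "Lyap f xs P c (stack (vector [y - \<alpha> *\<^sub>R (grad f y + w), x]))
    \<le> \<rho>\<^sup>2 * Lyap f xs P c (stack (vector [x, xm]))
      + w \<bullet> (- (\<alpha> * (Pt $ 1 $ 2 + Pt $ 2 $ 1)) *\<^sub>R (x - xs))
      + w \<bullet> (- (2 * \<alpha> * Pt $ 1 $ 1) *\<^sub>R (y - xs - \<alpha> *\<^sub>R grad f y)
             + (c * (L * \<alpha>\<^sup>2 - \<alpha>)) *\<^sub>R grad f y)
      + \<alpha>\<^sup>2 * (Pt $ 1 $ 1 + c * L / 2) * (norm w)\<^sup>2"
proof -
  define a b e u where "a = x - xs" and "b = xm - xs" and "e = y - xs" and "u = grad f y"
  define q where "q = (\<lambda>a b :: real^'n. Pt $ 1 $ 1 * (a \<bullet> a) + (Pt $ 1 $ 2 + Pt $ 2 $ 1) * (a \<bullet> b) + Pt $ 2 $ 2 * (b \<bullet> b))"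
  define A1 where "A1 = \<mu> / 2 * ((\<beta> *\<^sub>R (b - a)) \<bullet> (\<beta> *\<^sub>R (b - a))) + u \<bullet> (\<beta> *\<^sub>R (b - a))"
  define A2 where "A2 = \<mu> / 2 * (e \<bullet> e) - u \<bullet> e"
  \<comment> \<open>The bookkeeping over plain reals: \<open>q1\<close> and \<open>q2\<close> are
    the quadratic form at the noiseless and the noisy next state, \<open>a1\<close> and
    \<open>a2\<close> the strong convexity terms. These and the \<open>uu\<close> terms cancel
    between the first two premises. The sum \<open>uu + wu + (wu + ww)\<close> has the shape of the
    expanded \<open>(u + w) \<bullet> (u + w)\<close>.\<close>
  have combine: "q2 + c * (F - fs) \<le> r * (q0 + c * (fx - fs)) + t1 + (t2 + c * (L * \<alpha>\<^sup>2 - \<alpha>) * wu)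
        + \<alpha>\<^sup>2 * (p + c * L / 2) * ww"
    if "q1 - r * q0 \<le> c * (r * a1 + (1 - r) * a2 + (\<alpha> - L * \<alpha>\<^sup>2 / 2) * uu)"
      and "c * F \<le> c * (r * (fx - a1) + (1 - r) * (fs - a2) - \<alpha> * (uu + wu)
        + L * \<alpha>\<^sup>2 / 2 * (uu + wu + (wu + ww)))"
      and "q2 = q1 + t1 + t2 + \<alpha>\<^sup>2 * p * ww"
    for q0 q1 q2 F fx fs r t1 t2 a1 a2 uu wu ww p :: real
    using that by (simp add: field_simps)
  have e: "e = (1 + \<beta>) *\<^sub>R a - \<beta> *\<^sub>R b"
    by (simp add: a_def b_def e_def y algebra_simps)
  have yx: "x - y = \<beta> *\<^sub>R (b - a)"
    by (simp add: a_def b_def y algebra_simps)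
  have yxs: "xs - y = - e"
    by (simp add: e_def)
  have "\<rho>\<^sup>2 \<le> 1"
    using \<open>\<bar>\<rho>\<bar> \<le> 1\<close> by (simp add: abs_square_le_1)
  have descent: "f (y - \<alpha> *\<^sub>R (u + w)) \<le> f y - \<alpha> * (u \<bullet> (u + w)) + L * \<alpha>\<^sup>2 / 2 * ((u + w) \<bullet> (u + w))"
    using smooth_strongly_convexD(1)[OF f, of "y - \<alpha> *\<^sub>R (u + w)" y]
    by (simp add: u_def dot_square_norm power_mult_distrib)
  have fx: "f y \<le> f x - A1"
    using smooth_strongly_convexD(2)[OF f, of y x] unfolding A1_def yx u_def[symmetric] power2_norm_eq_inner
    by linarith
  have fxs: "f y \<le> f xs - A2"
    using smooth_strongly_convexD(2)[OF f, of y xs] unfolding A2_def yxs u_def[symmetric] power2_norm_eq_inner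
    by simp
  \<comment> \<open>The weights of \<open>X_rho\<close> are nonnegative, so the two bounds may be
    averaged with them.\<close>
  have fy: "f y \<le> \<rho>\<^sup>2 * (f x - A1)
      + (1 - \<rho>\<^sup>2) * (f xs - A2)"
    using mult_left_mono[OF fx, of "\<rho>\<^sup>2"] mult_left_mono[OF fxs, of "1 - \<rho>\<^sup>2"] \<open>\<rho>\<^sup>2 \<le> 1\<close>
    by (simp add: left_diff_distrib)
  have "2 * c\<^sub>0 * (\<mu> * L * (e \<bullet> e) - (\<mu> + L) * (e \<bullet> u) + u \<bullet> u) \<le> 0"
    using smooth_strongly_convex_interpolation[OF f \<open>\<mu> \<le> L\<close>, where x = xs and y = y] crit \<open>0 \<le> c\<^sub>0\<close>
    by (intro mult_nonneg_nonpos) (auto simp: e_def u_def)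
  then have "q (e - \<alpha> *\<^sub>R u) a - \<rho>\<^sup>2 * q a b \<le>
      c * (\<rho>\<^sup>2 * A1
           + (1 - \<rho>\<^sup>2) * A2
           + (\<alpha> - L * \<alpha>\<^sup>2 / 2) * (u \<bullet> u))"
    using AG_matrix_inequality_quadratic[OF LMI[unfolded P], of a b u] unfolding q_def A1_def A2_def e by linarith
  moreover have "c * f (y - \<alpha> *\<^sub>R (u + w)) \<le>
      c * (\<rho>\<^sup>2 * (f x - A1)
      + (1 - \<rho>\<^sup>2) * (f xs - A2)
      - \<alpha> * (u \<bullet> (u + w)) + L * \<alpha>\<^sup>2 / 2 * ((u + w) \<bullet> (u + w)))"
    using \<open>0 \<le> c\<close> descent fy by (intro mult_left_mono) linarith+
  moreover have "q (e - \<alpha> *\<^sub>R (u + w)) a = q (e - \<alpha> *\<^sub>R u) a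
      + w \<bullet> (- (\<alpha> * (Pt $ 1 $ 2 + Pt $ 2 $ 1)) *\<^sub>R a)
      + w \<bullet> (- (2 * \<alpha> * Pt $ 1 $ 1) *\<^sub>R (e - \<alpha> *\<^sub>R u)) + \<alpha>\<^sup>2 * Pt $ 1 $ 1 * (w \<bullet> w)"
    unfolding q_def
    by (simp add: inner_diff_left inner_diff_right inner_add_left inner_add_right
          inner_commute power2_eq_square algebra_simps)
  ultimately have "q (e - \<alpha> *\<^sub>R (u + w)) a + c * (f (y - \<alpha> *\<^sub>R (u + w)) - f xs)
    \<le> \<rho>\<^sup>2 * (q a b + c * (f x - f xs))
      + w \<bullet> (- (\<alpha> * (Pt $ 1 $ 2 + Pt $ 2 $ 1)) *\<^sub>R a)
      + (w \<bullet> (- (2 * \<alpha> * Pt $ 1 $ 1) *\<^sub>R (e - \<alpha> *\<^sub>R u)) + c * (L * \<alpha>\<^sup>2 - \<alpha>) * (w \<bullet> u))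
      + \<alpha>\<^sup>2 * (Pt $ 1 $ 1 + c * L / 2) * (w \<bullet> w)"
    unfolding inner_add_left inner_add_right inner_commute[of u w] by (rule combine)
  moreover have shift: "y - \<alpha> *\<^sub>R (u + w) - xs = e - \<alpha> *\<^sub>R (u + w)"
    by (simp add: e_def)
  ultimately show ?thesis
    unfolding P Lyap_stack a_def[symmetric] b_def[symmetric] u_def[symmetric] e_def[symmetric]
      power2_norm_eq_inner q_def shift inner_add_right[of w] inner_scaleR_right
    by linarith
qed

section \<open>The Schur complement and the lower bound for the Lyapunov function\<close>

lemma psd_2_imp:
  fixes Pt :: "real^2^2"
  assumes "psd Pt"
  shows "Pt $ 2 $ 1 = Pt $ 1 $ 2"
    and "0 \<le> Pt $ 1 $ 1 * s\<^sup>2 + 2 * Pt $ 1 $ 2 * s * t + Pt $ 2 $ 2 * t\<^sup>2"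
proof -
  have "transpose Pt $ 1 $ 2 = Pt $ 1 $ 2"
    using assms by (simp add: psd_def)
  then show *: "Pt $ 2 $ 1 = Pt $ 1 $ 2"
    by (simp add: transpose_def)
  have "0 \<le> vector [s, t] \<bullet> (Pt *v vector [s, t])"
    using assms by (simp add: psd_def)
  then show "0 \<le> Pt $ 1 $ 1 * s\<^sup>2 + 2 * Pt $ 1 $ 2 * s * t + Pt $ 2 $ 2 * t\<^sup>2"
    by (simp add: inner_vec_def matrix_vector_mult_def sum_2 * power2_eq_square algebra_simps)
qed

text \<open>For positive semidefinite \<open>Pt\<close> this is the minimum over \<open>t\<close> of
  the quadratic form at \<open>(1, t)\<close>. If \<open>Pt $ 2 $ 2 = 0\<close>, semidefiniteness
  forces \<open>Pt $ 1 $ 2 = 0\<close> and the form is constant in \<open>t\<close>.\<close>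

definition schur_11 :: "real^2^2 \<Rightarrow> real" where
  "schur_11 Pt = (if Pt $ 2 $ 2 > 0 then Pt $ 1 $ 1 - (Pt $ 1 $ 2)\<^sup>2 / Pt $ 2 $ 2 else Pt $ 1 $ 1)"

text \<open>The value is attained by the form, at \<open>t = - (Pt $ 1 $ 2) / Pt $ 2 $ 2\<close> or
  at \<open>t = 0\<close>.\<close>

lemma schur_11_nonneg:
  assumes "psd Pt"
  shows "0 \<le> schur_11 Pt"
proof (cases "Pt $ 2 $ 2 > 0")
  case True
  then show ?thesis
    using psd_2_imp(2)[OF assms, of 1 "- (Pt $ 1 $ 2) / Pt $ 2 $ 2"]
    by (simp add: schur_11_def power2_eq_square)
next
  case False
  then show ?thesis
    using psd_2_imp(2)[OF assms, of 1 0] by (simp add: schur_11_def)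
qed

text \<open>Completing the square in \<open>b\<close>: for \<open>Pt $ 2 $ 2 > 0\<close> the
  difference of the two sides is \<open>Pt $ 2 $ 2 * (?v \<bullet> ?v)\<close>.\<close>

lemma schur_11_le_quadratic:
  fixes a b :: "'a::real_inner"
  assumes "psd Pt"
  shows "schur_11 Pt * (a \<bullet> a) \<le>
    Pt $ 1 $ 1 * (a \<bullet> a) + (Pt $ 1 $ 2 + Pt $ 2 $ 1) * (a \<bullet> b) + Pt $ 2 $ 2 * (b \<bullet> b)"
proof (cases "Pt $ 2 $ 2 > 0")
  case True
  let ?v = "b + (Pt $ 1 $ 2 / Pt $ 2 $ 2) *\<^sub>R a"
  have "0 \<le> Pt $ 2 $ 2 * (?v \<bullet> ?v)"
    using True by simp
  also have "\<dots> = (Pt $ 1 $ 2)\<^sup>2 / Pt $ 2 $ 2 * (a \<bullet> a) + 2 * Pt $ 1 $ 2 * (a \<bullet> b) + Pt $ 2 $ 2 * (b \<bullet> b)"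
    using True
    by (simp add: inner_add_left inner_add_right inner_commute power2_eq_square field_simps)
  finally show ?thesis
    using True by (simp add: schur_11_def psd_2_imp(1)[OF assms] left_diff_distrib)
next
  case False
  then have 22: "Pt $ 2 $ 2 = 0"
    using psd_2_imp(2)[OF assms, of 0 1] by simp
  have "Pt $ 1 $ 2 = 0"
  proof (rule ccontr)
    assume "Pt $ 1 $ 2 \<noteq> 0"
    \<comment> \<open>With \<open>Pt $ 2 $ 2 = 0\<close> the form takes the value \<open>-1\<close>
      at this point.\<close>
    then show False
      using psd_2_imp(2)[OF assms, of 1 "- (Pt $ 1 $ 1 + 1) / (2 * Pt $ 1 $ 2)"] 22 by simp
  qed
  then show ?thesis
    using False 22 by (simp add: schur_11_def psd_2_imp(1)[OF assms])
qed

text \<open>One formula for both cases of \<open>R_AG\<close>: without a positive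
  \<open>Pt $ 2 $ 2\<close> the quotient has equal positive numerator and denominator.\<close>

lemma R_AG_schur_11:
  assumes "psd Pt" and "0 < c * L"
  shows "R_AG L d \<rho> Pt c \<alpha> =
    L * \<alpha>\<^sup>2 * real d / (2 * (1 - \<rho>\<^sup>2)) * ((c * L + 2 * Pt $ 1 $ 1) / (c * L + 2 * schur_11 Pt))"
proof (cases "Pt $ 2 $ 2 > 0")
  case False
  then have "c * L + 2 * Pt $ 1 $ 1 > 0"
    using schur_11_nonneg[OF assms(1)] assms(2) by (simp add: schur_11_def)
  then show ?thesis using False by (simp add: R_AG_def schur_11_def)
qed (simp add: R_AG_def schur_11_def)

text \<open>Multiplied by \<open>L\<close>, the lower bound for the Lyapunov function shows the
  denominator of \<open>R_AG_schur_11\<close> as its factor.\<close>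

lemma suboptimality_le_Lyap:
  fixes a b xs :: "real^'n::finite"
  assumes f: "f \<in> smooth_strongly_convex \<mu> L" and crit: "grad f xs = 0"
    and "psd Pt" "0 < L"
  shows "(c * L + 2 * schur_11 Pt) * (f a - f xs) \<le> L * Lyap f xs (Pt \<otimes>\<^sub>K (mat 1 :: real^'n^'n)) c (stack (vector [a, b]))"
proof -
  have "2 * (f a - f xs) \<le> L * ((a - xs) \<bullet> (a - xs))"
    using smooth_strongly_convexD(1)[OF f, of a xs] crit by (simp add: dot_square_norm)
  then have "schur_11 Pt * (2 * (f a - f xs)) \<le> schur_11 Pt * (L * ((a - xs) \<bullet> (a - xs)))"
    by (intro mult_left_mono schur_11_nonneg \<open>psd Pt\<close>)
  moreover have "L * (schur_11 Pt * ((a - xs) \<bullet> (a - xs))) \<le>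
    L * (Pt $ 1 $ 1 * ((a - xs) \<bullet> (a - xs)) + (Pt $ 1 $ 2 + Pt $ 2 $ 1) * ((a - xs) \<bullet> (b - xs))
      + Pt $ 2 $ 2 * ((b - xs) \<bullet> (b - xs)))"
    using \<open>0 < L\<close> by (intro mult_left_mono schur_11_le_quadratic \<open>psd Pt\<close>) simp
  ultimately show ?thesis
    unfolding Lyap_stack by (simp add: algebra_simps)
qed

section \<open>Independence, square integrability and the noise terms\<close>

lemma sigma_sets_comp_subset:
  fixes h :: "'b::topological_space \<Rightarrow> 'c::topological_space"
  assumes "h \<in> borel_measurable borel"
  shows "sigma_sets \<Omega> {(\<lambda>\<omega>. h (X \<omega>)) -` S \<inter> \<Omega> | S. S \<in> sets borel}
    \<subseteq> sigma_sets \<Omega> {X -` S \<inter> \<Omega> | S. S \<in> sets borel}"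
proof (rule sigma_sets_mono')
  show "{(\<lambda>\<omega>. h (X \<omega>)) -` S \<inter> \<Omega> | S. S \<in> sets borel} \<subseteq> {X -` S \<inter> \<Omega> | S. S \<in> sets borel}"
  proof safe
    fix S :: "'c set"
    assume "S \<in> sets borel"
    then have "h -` S \<in> sets borel"
      using measurable_sets[OF assms] by simp
    then show "\<exists>T. (\<lambda>\<omega>. h (X \<omega>)) -` S \<inter> \<Omega> = X -` T \<inter> \<Omega> \<and> T \<in> sets borel"
      by (intro exI[of _ "h -` S"]) auto
  qed
qed

text \<open>Borel functions only shrink the generated sigma-algebras, and so does picking one member
  of the family. Mapping both variables into a common type makes \<open>indep_var\<close>
  applicable.\<close>

lemma indep_of_family_imp_indep_var:
  assumes "prob_space M" and "indep_of_family M w Z I" and "i \<in> I"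
    and "g \<in> borel_measurable borel" "h \<in> borel_measurable borel"
  shows "prob_space.indep_var M borel (\<lambda>\<omega>. g (w \<omega>)) borel (\<lambda>\<omega>. h (Z i \<omega>))"
proof -
  interpret prob_space M by fact
  let ?F = "sigma_sets (space M) (\<Union>i\<in>I. {Z i -` S \<inter> space M | S. S \<in> sets borel})"
  let ?G = "sigma_sets (space M) {w -` S \<inter> space M | S. S \<in> sets borel}"
  have ind: "indep_set ?G ?F" and meas: "w \<in> borel_measurable M" "Z i \<in> borel_measurable M"
    using assms(2,3) by (auto simp: indep_of_family_def)
  have "sigma_sets (space M) {(\<lambda>\<omega>. h (Z i \<omega>)) -` S \<inter> space M | S. S \<in> sets borel}
      \<subseteq> sigma_sets (space M) {Z i -` S \<inter> space M | S. S \<in> sets borel}"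
    by (rule sigma_sets_comp_subset) fact
  also have "\<dots> \<subseteq> ?F"
    using \<open>i \<in> I\<close> by (intro sigma_sets_mono') blast
  finally have *: "sigma_sets (space M) {(\<lambda>\<omega>. h (Z i \<omega>)) -` S \<inter> space M | S. S \<in> sets borel} \<subseteq> ?F" .
  show ?thesis
    unfolding indep_var_eq
  proof (intro conjI)
    show "indep_set
       (sigma_sets (space M) {(\<lambda>\<omega>. g (w \<omega>)) -` S \<inter> space M | S. S \<in> sets borel})
       (sigma_sets (space M) {(\<lambda>\<omega>. h (Z i \<omega>)) -` S \<inter> space M | S. S \<in> sets borel})"
      using ind * sigma_sets_comp_subset[OF assms(4), of "space M" w]
      unfolding indep_set_def
      by (rule_tac indep_sets_mono_sets) (auto split: bool.split)
  qed (use meas assms(4,5) in auto)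
qed

text \<open>Coordinatewise, each summand is a product of independent integrable reals, one of them
  centred; independence yields both integrability and zero mean.\<close>

lemma has_bochner_integral_inner_indep:
  fixes w :: "'w \<Rightarrow> 'a::euclidean_space" and h :: "'b::topological_space \<Rightarrow> 'a"
  assumes "prob_space M" and "indep_of_family M w Z I" and "i \<in> I"
    and "has_bochner_integral M w 0"
    and "h \<in> borel_measurable borel" and "integrable M (\<lambda>\<omega>. h (Z i \<omega>))"
  shows "has_bochner_integral M (\<lambda>\<omega>. w \<omega> \<bullet> h (Z i \<omega>)) 0"
proof -
  interpret prob_space M by fact
  have "has_bochner_integral M (\<lambda>\<omega>. (w \<omega> \<bullet> b) * (h (Z i \<omega>) \<bullet> b)) 0" for b
  proof -
    have ind: "indep_var borel (\<lambda>\<omega>. w \<omega> \<bullet> b) borel (\<lambda>\<omega>. h (Z i \<omega>) \<bullet> b)"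
      using assms(5)
      by (intro indep_of_family_imp_indep_var[OF assms(1-3), where g = "\<lambda>v. v \<bullet> b" and h = "\<lambda>z. h z \<bullet> b"]) auto
    have w: "has_bochner_integral M (\<lambda>\<omega>. w \<omega> \<bullet> b) (0 \<bullet> b)"
      using assms(4) by (rule has_bochner_integral_inner_left)
    have h: "integrable M (\<lambda>\<omega>. h (Z i \<omega>) \<bullet> b)"
      using assms(6) by auto
    show ?thesis
      unfolding has_bochner_integral_iff
      using indep_var_integrable[OF ind _ h] indep_var_lebesgue_integral[OF ind _ h] w
      by (auto simp: has_bochner_integral_iff)
  qed
  then have "has_bochner_integral M (\<lambda>\<omega>. \<Sum>b\<in>Basis. (w \<omega> \<bullet> b) * (h (Z i \<omega>) \<bullet> b)) (\<Sum>b\<in>(Basis :: 'a set). 0)"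
    by (intro has_bochner_integral_sum)
  moreover have eq: "w \<omega> \<bullet> h (Z i \<omega>) = (\<Sum>b\<in>Basis. (w \<omega> \<bullet> b) * (h (Z i \<omega>) \<bullet> b))" for \<omega>
    by (rule euclidean_inner)
  ultimately show ?thesis
    unfolding eq by simp
qed

text \<open>The squared norm is the trace of the outer product, and the trace, being linear,
  commutes with the integral.\<close>

lemma has_bochner_integral_norm_sq_outer:
  fixes w :: "'w \<Rightarrow> real^'n::finite"
  assumes "has_bochner_integral M (\<lambda>\<omega>. outer (w \<omega>)) (s *\<^sub>R mat 1)"
  shows "has_bochner_integral M (\<lambda>\<omega>. (norm (w \<omega>))\<^sup>2) (s * real CARD('n))"
proof -
  have "linear (trace :: real^'n^'n \<Rightarrow> real)"
    by (auto simp: linear_iff trace_def sum.distrib sum_distrib_left)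
  then have "bounded_linear (trace :: real^'n^'n \<Rightarrow> real)"
    by (simp add: linear_conv_bounded_linear)
  then have "has_bochner_integral M (\<lambda>\<omega>. trace (outer (w \<omega>))) (trace (s *\<^sub>R mat 1 :: real^'n^'n))"
    using assms by (rule has_bochner_integral_bounded_linear)
  moreover have "trace (outer v) = (norm v)\<^sup>2" for v :: "real^'n"
    by (simp add: trace_def outer_def power2_norm_eq_inner inner_vec_def)
  moreover have "trace (s *\<^sub>R mat 1 :: real^'n^'n) = s * real CARD('n)"
    by (simp add: trace_def mat_def)
  ultimately show ?thesis by simp
qed

text \<open>The invariant carried along the iteration: it survives linear combinations and the
  gradient map, and inner products of two such functions are integrable.\<close>

definition square_integrable :: "'w measure \<Rightarrow> ('w \<Rightarrow> 'a::euclidean_space) \<Rightarrow> bool" where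
  "square_integrable M v \<longleftrightarrow> v \<in> borel_measurable M \<and> integrable M (\<lambda>\<omega>. (norm (v \<omega>))\<^sup>2)"

lemma square_integrable_bound:
  assumes "square_integrable M v" and "u \<in> borel_measurable M"
    and "\<And>\<omega>. \<omega> \<in> space M \<Longrightarrow> norm (u \<omega>) \<le> K * norm (v \<omega>)"
  shows "square_integrable M u"
  unfolding square_integrable_def
proof
  have "integrable M (\<lambda>\<omega>. K\<^sup>2 * (norm (v \<omega>))\<^sup>2)"
    using assms(1) by (auto simp: square_integrable_def)
  then show "integrable M (\<lambda>\<omega>. (norm (u \<omega>))\<^sup>2)"
  proof (rule Bochner_Integration.integrable_bound)
    show "AE \<omega> in M. norm ((norm (u \<omega>))\<^sup>2) \<le> norm (K\<^sup>2 * (norm (v \<omega>))\<^sup>2)"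
      using assms(3) by (intro AE_I2) (auto simp: power_mult_distrib[symmetric] intro!: power_mono)
  qed (use assms(2) in auto)
qed fact

lemma square_integrable_scaleR:
  "square_integrable M v \<Longrightarrow> square_integrable M (\<lambda>\<omega>. k *\<^sub>R v \<omega>)"
  by (rule square_integrable_bound[where v = v and K = "\<bar>k\<bar>"]) (auto simp: square_integrable_def)

lemma square_integrable_add:
  assumes "square_integrable M u" "square_integrable M v"
  shows "square_integrable M (\<lambda>\<omega>. u \<omega> + v \<omega>)"
  unfolding square_integrable_def
proof
  have "integrable M (\<lambda>\<omega>. 2 * (norm (u \<omega>))\<^sup>2 + 2 * (norm (v \<omega>))\<^sup>2)"
    using assms by (auto simp: square_integrable_def)
  then show "integrable M (\<lambda>\<omega>. (norm (u \<omega> + v \<omega>))\<^sup>2)"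
  proof (rule Bochner_Integration.integrable_bound)
    \<comment> \<open>By the parallelogram law the gap is
      \<open>(norm (a - b))\<^sup>2\<close>.\<close>
    have "(norm (a + b))\<^sup>2 \<le> 2 * (norm a)\<^sup>2 + 2 * (norm b)\<^sup>2" for a b :: 'b
      using inner_ge_zero[of "a - b"]
      by (simp add: power2_norm_eq_inner inner_add_left inner_add_right inner_diff_left
          inner_diff_right inner_commute)
    then show "AE \<omega> in M. norm ((norm (u \<omega> + v \<omega>))\<^sup>2) \<le> norm (2 * (norm (u \<omega>))\<^sup>2 + 2 * (norm (v \<omega>))\<^sup>2)"
      by (intro AE_I2) simp
  qed (use assms in \<open>auto simp: square_integrable_def\<close>)
qed (use assms in \<open>auto simp: square_integrable_def\<close>)

lemma square_integrable_diff:
  assumes "square_integrable M u" "square_integrable M v"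
  shows "square_integrable M (\<lambda>\<omega>. u \<omega> - v \<omega>)"
  using square_integrable_add[OF assms(1) square_integrable_scaleR[OF assms(2), of "-1"]] by simp

lemma square_integrable_const: "finite_measure M \<Longrightarrow> square_integrable M (\<lambda>_. a)"
  by (simp add: square_integrable_def finite_measure.integrable_const)

lemma square_integrable_cong:
  "(\<And>\<omega>. \<omega> \<in> space M \<Longrightarrow> u \<omega> = v \<omega>) \<Longrightarrow> square_integrable M u \<longleftrightarrow> square_integrable M v"
  unfolding square_integrable_def
  by (intro conj_cong measurable_cong Bochner_Integration.integrable_cong) auto

lemma integrable_inner_square_integrable:
  assumes "square_integrable M u" "square_integrable M v"
  shows "integrable M (\<lambda>\<omega>. u \<omega> \<bullet> v \<omega>)"
proof (rule Bochner_Integration.integrable_bound)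
  show "integrable M (\<lambda>\<omega>. (norm (u \<omega>))\<^sup>2 + (norm (v \<omega>))\<^sup>2)"
    using assms by (auto simp: square_integrable_def)
  have "\<bar>a \<bullet> b\<bar> \<le> (norm a)\<^sup>2 + (norm b)\<^sup>2" for a b :: 'b
    using Cauchy_Schwarz_ineq2[of a b] sum_squares_bound[of "norm a" "norm b"]
      mult_nonneg_nonneg[of "norm a" "norm b"] by simp
  then show "AE \<omega> in M. norm (u \<omega> \<bullet> v \<omega>) \<le> norm ((norm (u \<omega>))\<^sup>2 + (norm (v \<omega>))\<^sup>2)"
    by (intro AE_I2) simp
qed (use assms in \<open>auto simp: square_integrable_def\<close>)

lemma integrable_square_integrable:
  assumes "finite_measure M" "square_integrable M u"
  shows "integrable M u"
proof (rule Bochner_Integration.integrable_bound)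
  interpret finite_measure M by fact
  show "integrable M (\<lambda>\<omega>. 1 + (norm (u \<omega>))\<^sup>2)"
    using assms by (auto simp: square_integrable_def)
  have "norm a \<le> 1 + (norm a)\<^sup>2" for a :: 'b
    using sum_squares_bound[of 1 "norm a"] norm_ge_zero[of a] by (simp del: norm_ge_zero)
  then show "AE \<omega> in M. norm (u \<omega>) \<le> norm (1 + (norm (u \<omega>))\<^sup>2)"
    by (intro AE_I2) simp
qed (use assms in \<open>auto simp: square_integrable_def\<close>)

lemma borel_measurable_block [measurable]: "block a \<in> borel_measurable borel"
  unfolding block_def
  by (intro borel_measurable_continuous_onI continuous_on_vec_lambda continuous_intros)

lemma square_integrable_grad:
  assumes f: "f \<in> smooth_strongly_convex \<mu> L" "0 < \<mu>" "\<mu> \<le> L" "grad f xs = 0"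
    and "finite_measure M" and v: "square_integrable M v"
  shows "square_integrable M (\<lambda>\<omega>. grad f (v \<omega> :: real^'n::finite))"
proof (rule square_integrable_bound)
  show "square_integrable M (\<lambda>\<omega>. v \<omega> - xs)"
    by (intro square_integrable_diff v square_integrable_const) fact
  show "norm (grad f (v \<omega>)) \<le> (\<mu> + L) * norm (v \<omega> - xs)" for \<omega>
    by (rule norm_grad_le[OF f])
  have "grad f \<in> borel_measurable borel"
    by (rule borel_measurable_continuous_onI[OF smooth_strongly_convexD(3)[OF f(1)]])
  then show "(\<lambda>\<omega>. grad f (v \<omega>)) \<in> borel_measurable M"
    using v by (auto simp: square_integrable_def)
qed

text \<open>Minimality and smoothness at the critical point place the integrand between
  \<open>0\<close> and \<open>L / 2 * (norm (v \<omega> - xs))\<^sup>2\<close>.\<close>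

lemma integrable_suboptimality:
  fixes v :: "'w \<Rightarrow> real^'n::finite"
  assumes f: "f \<in> smooth_strongly_convex \<mu> L" and "0 \<le> L" "grad f xs = 0"
    and min: "\<And>z. f xs \<le> f z" and "finite_measure M" and v: "square_integrable M v"
  shows "integrable M (\<lambda>\<omega>. f (v \<omega>) - f xs)"
proof (rule Bochner_Integration.integrable_bound)
  have "square_integrable M (\<lambda>\<omega>. v \<omega> - xs)"
    by (intro square_integrable_diff v square_integrable_const) fact
  then show "integrable M (\<lambda>\<omega>. L / 2 * (norm (v \<omega> - xs))\<^sup>2)"
    by (simp add: square_integrable_def)
  show "AE \<omega> in M. norm (f (v \<omega>) - f xs) \<le> norm (L / 2 * (norm (v \<omega> - xs))\<^sup>2)"
  proof (rule AE_I2)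
    fix \<omega>
    show "norm (f (v \<omega>) - f xs) \<le> norm (L / 2 * (norm (v \<omega> - xs))\<^sup>2)"
      using smooth_strongly_convexD(1)[OF f, of "v \<omega>" xs] min[of "v \<omega>"] \<open>0 \<le> L\<close> \<open>grad f xs = 0\<close>
      by simp
  qed
  have "f \<in> borel_measurable borel"
    by (rule borel_measurable_continuous_onI[OF smooth_strongly_convex_continuous[OF f]])
  then show "(\<lambda>\<omega>. f (v \<omega>) - f xs) \<in> borel_measurable M"
    using v by (auto simp: square_integrable_def)
qed

lemma integrable_Lyap:
  fixes u v :: "'w \<Rightarrow> real^'n::finite"
  assumes "f \<in> smooth_strongly_convex \<mu> L" "0 \<le> L" "grad f xs = 0" "\<And>z. f xs \<le> f z"
    and "finite_measure M" "square_integrable M u" "square_integrable M v"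
  shows "integrable M (\<lambda>\<omega>. Lyap f xs (Pt \<otimes>\<^sub>K (mat 1 :: real^'n^'n)) c (stack (vector [u \<omega>, v \<omega>])))"
proof -
  have "square_integrable M (\<lambda>\<omega>. u \<omega> - xs)" "square_integrable M (\<lambda>\<omega>. v \<omega> - xs)"
    by (intro square_integrable_diff square_integrable_const assms)+
  moreover have "integrable M (\<lambda>\<omega>. f (u \<omega>) - f xs)"
    by (rule integrable_suboptimality) fact+
  ultimately show ?thesis
    unfolding Lyap_stack
    by (intro Bochner_Integration.integrable_add integrable_mult_right integrable_inner_square_integrable)
qed

text \<open>The family \<open>{1..k}\<close> is empty for \<open>k = 0\<close>, so independence says
  nothing there; the deterministic start makes \<open>v\<close> constant instead.\<close>

lemma indep_noise_cross_term:
  fixes w :: "'w \<Rightarrow> 'a::euclidean_space" and k :: nat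
  assumes "prob_space M" and "indep_of_family M w Z {1..k}"
    and w: "has_bochner_integral M w 0"
    and "h \<in> borel_measurable borel" "square_integrable M v"
    and v: "\<And>\<omega>. \<omega> \<in> space M \<Longrightarrow> v \<omega> = h (Z k \<omega>)"
    and const: "\<And>\<omega>. \<omega> \<in> space M \<Longrightarrow> k = 0 \<Longrightarrow> v \<omega> = v0"
  shows "has_bochner_integral M (\<lambda>\<omega>. w \<omega> \<bullet> v \<omega>) 0"
proof (cases "k = 0")
  case True
  have "has_bochner_integral M (\<lambda>\<omega>. w \<omega> \<bullet> v0) (0 \<bullet> v0)"
    by (rule has_bochner_integral_inner_left[OF w])
  then show ?thesis
    using const True by (subst has_bochner_integral_cong[OF refl _ refl]) auto
next
  case False
  have "finite_measure M"
    using assms(1) by (simp add: prob_space_def)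
  then have "integrable M v"
    by (rule integrable_square_integrable) fact
  then have "integrable M (\<lambda>\<omega>. h (Z k \<omega>))"
    using v by (subst Bochner_Integration.integrable_cong[OF refl]) auto
  then have "has_bochner_integral M (\<lambda>\<omega>. w \<omega> \<bullet> h (Z k \<omega>)) 0"
    using False by (intro has_bochner_integral_inner_indep[OF assms(1,2) _ w assms(4)]) auto
  then show ?thesis
    using v by (subst has_bochner_integral_cong[OF refl _ refl]) auto
qed

section \<open>The recursion in expectation and the final bounds\<close>

text \<open>\<open>N / (1 - r)\<close> is the fixed point of \<open>t \<mapsto> r * t + N\<close>,
  and the excess over it shrinks by the factor \<open>r\<close> in each step.\<close>

lemma affine_recursion_bound:
  fixes e :: "nat \<Rightarrow> real"
  assumes "0 \<le> r" "r < 1" and "\<And>k. e (Suc k) \<le> r * e k + N"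
  shows "e k \<le> r ^ k * e 0 + (1 - r ^ k) * (N / (1 - r))"
proof (induction k)
  case (Suc k)
  have "e (Suc k) \<le> r * (r ^ k * e 0 + (1 - r ^ k) * (N / (1 - r))) + N"
    using assms(3)[of k] mult_left_mono[OF Suc assms(1)] by linarith
  also have "\<dots> = r ^ Suc k * e 0 + (1 - r ^ Suc k) * (N / (1 - r))"
    using \<open>r < 1\<close> by (simp add: field_simps)
  finally show ?case .
qed simp

theorem corollary4p7:
  fixes M :: "'w measure"
    and f :: "real^'n::finite \<Rightarrow> real"
    and xs x0 xm1 :: "real^'n"
    and x :: "int \<Rightarrow> 'w \<Rightarrow> real^'n"
    and y w :: "nat \<Rightarrow> 'w \<Rightarrow> real^'n"
    and \<xi> :: "nat \<Rightarrow> 'w \<Rightarrow> real^(2 \<times> 'n)"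
    and \<mu> L \<alpha> \<beta> \<sigma> \<rho> c\<^sub>0 c :: real
    and Pt :: "real^2^2"
    and P :: "real^(2 \<times> 'n)^(2 \<times> 'n)"
  assumes "prob_space M"
    and "0 < \<mu>" and "\<mu> \<le> L"
    and "f \<in> smooth_strongly_convex \<mu> L"
    and "\<And>z. f xs \<le> f z"
    and "\<And>\<omega>. \<omega> \<in> space M \<Longrightarrow> x 0 \<omega> = x0"
    and "\<And>\<omega>. \<omega> \<in> space M \<Longrightarrow> x (-1) \<omega> = xm1"
    and "\<And>k \<omega>. \<omega> \<in> space M \<Longrightarrow>
           y k \<omega> = (1 + \<beta>) *\<^sub>R x (int k) \<omega> - \<beta> *\<^sub>R x (int k - 1) \<omega>"
    and "\<And>k \<omega>. \<omega> \<in> space M \<Longrightarrow>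
           x (int k + 1) \<omega> = y k \<omega> - \<alpha> *\<^sub>R (grad f (y k \<omega>) + w k \<omega>)"
    and "\<And>k \<omega>. \<omega> \<in> space M \<Longrightarrow> \<xi> k \<omega> = stack (vector [x (int k) \<omega>, x (int k - 1) \<omega>])"
    and "noise_assumption M \<sigma> \<xi> y w"
    and "0 < \<rho>" and "\<rho> < 1"
    and "psd Pt" and "c\<^sub>0 \<ge> 0" and "c > 0"
    and "P = Pt \<otimes>\<^sub>K (mat 1 :: real^'n^'n)"
    and "c\<^sub>0 *\<^sub>R X0 \<mu> L \<beta> + c *\<^sub>R X_rho \<mu> L \<alpha> \<beta> \<rho> \<succeq> Phi (AG_A \<beta>) (AG_B \<alpha>) P \<rho>"
  shows "(\<forall>k. integrable M (\<lambda>\<omega>. f (x (int k) \<omega>) - f xs) \<and>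
           (\<integral>\<omega>. f (x (int k) \<omega>) - f xs \<partial>M) \<le>
             \<rho> ^ (2 * k) * (1 / c * Lyap f xs P c (stack (vector [x0, xm1])))
             + (1 - \<rho> ^ (2 * k)) * (\<sigma>\<^sup>2 * R_AG L CARD('n) \<rho> Pt c \<alpha>)) \<and>
         limsup (\<lambda>k. ereal (1 / \<sigma>\<^sup>2 * (\<integral>\<omega>. f (x (int k) \<omega>) - f xs \<partial>M)))
           \<le> ereal (R_AG L CARD('n) \<rho> Pt c \<alpha>)"
proof -
  interpret prob_space M by fact
  have fin: "finite_measure M"
    by (rule finite_measure_axioms)
  note f = \<open>f \<in> smooth_strongly_convex \<mu> L\<close> and min = \<open>\<And>z. f xs \<le> f z\<close>
    and init = assms(6,7) and y_eq = assms(8) and x_step = assms(9) and \<xi>_eq = assms(10)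
    and P = \<open>P = Pt \<otimes>\<^sub>K (mat 1 :: real^'n^'n)\<close>
  have "0 < L"
    using \<open>0 < \<mu>\<close> \<open>\<mu> \<le> L\<close> by simp
  have crit: "grad f xs = 0"
    by (rule grad_minimizer_eq_0[OF f \<open>0 < L\<close> min])
  have \<sigma>: "\<sigma> > 0" and w0: "has_bochner_integral M (w k) 0"
    and ww: "has_bochner_integral M (\<lambda>\<omega>. (norm (w k \<omega>))\<^sup>2) (\<sigma>\<^sup>2 * real CARD('n))"
    and ind\<xi>: "indep_of_family M (w k) \<xi> {1..k}"
    and indy: "indep_of_family M (w k) y {1..k}" for k
    using \<open>noise_assumption M \<sigma> \<xi> y w\<close> has_bochner_integral_norm_sq_outer
    by (auto simp: noise_assumption_def)
  have sq_w: "square_integrable M (w k)" for k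
    using w0[of k] ww[of k] by (auto simp: square_integrable_def has_bochner_integral_iff)
  have sq_grad: "square_integrable M (\<lambda>\<omega>. grad f (v \<omega>))" if "square_integrable M v" for v
    by (rule square_integrable_grad[OF f \<open>0 < \<mu>\<close> \<open>\<mu> \<le> L\<close> crit fin that])
  \<comment> \<open>Conditional, since the induction for \<open>sq_x\<close> already uses it to pass
    from two iterates to the next.\<close>
  have sq_y_if: "square_integrable M (y k)"
    if "square_integrable M (x (int k))" "square_integrable M (x (int k - 1))" for k
    using that y_eq[of _ k]
    by (subst square_integrable_cong[where v = "\<lambda>\<omega>. (1 + \<beta>) *\<^sub>R x (int k) \<omega> - \<beta> *\<^sub>R x (int k - 1) \<omega>"])
      (auto intro!: square_integrable_diff square_integrable_scaleR)
  \<comment> \<open>The recursion has order two, so the induction carries two consecutive iterates,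
    starting with the indices \<open>0\<close> and \<open>-1\<close>.\<close>
  have sq_x: "square_integrable M (x (int k)) \<and> square_integrable M (x (int k - 1))" for k
  proof (induction k)
    case 0
    show ?case
      using square_integrable_cong[of M "x 0" "\<lambda>_. x0"] square_integrable_cong[of M "x (-1)" "\<lambda>_. xm1"]
        init square_integrable_const[OF fin] by auto
  next
    case (Suc k)
    have "square_integrable M (\<lambda>\<omega>. y k \<omega> - \<alpha> *\<^sub>R (grad f (y k \<omega>) + w k \<omega>))"
      using Suc by (intro square_integrable_diff square_integrable_scaleR square_integrable_add
          sq_grad sq_y_if sq_w) auto
    then have "square_integrable M (x (int k + 1))"
      using x_step[of _ k] by (subst square_integrable_cong) auto
    then show ?case
      using Suc by (simp add: add.commute)
  qed
  then have sq_y: "square_integrable M (y k)" for k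
    by (intro sq_y_if) auto
  define V where "V k \<omega> = Lyap f xs P c (stack (vector [x (int k) \<omega>, x (int k - 1) \<omega>]))" for k \<omega>
  \<comment> \<open>The expectation of the term of \<open>Lyap_AG_step\<close> quadratic in the
    noise.\<close>
  define N where "N = \<alpha>\<^sup>2 * (Pt $ 1 $ 1 + c * L / 2) * (\<sigma>\<^sup>2 * real CARD('n))"
  have V_int: "integrable M (V k)" for k
    unfolding V_def P using sq_x[of k] \<open>0 < L\<close>
    by (intro integrable_Lyap[OF f _ crit min fin]) auto
  have f_int: "integrable M (\<lambda>\<omega>. f (x (int k) \<omega>) - f xs)" for k
    using sq_x[of k] \<open>0 < L\<close> by (intro integrable_suboptimality[OF f _ crit min fin]) auto
  have V_step: "(\<integral>\<omega>. V (Suc k) \<omega> \<partial>M) \<le> \<rho>\<^sup>2 * (\<integral>\<omega>. V k \<omega> \<partial>M) + N" for k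
  proof -
    \<comment> \<open>The two factors paired with \<open>w\<close> in \<open>Lyap_AG_step\<close>.
      The first reaches \<open>\<xi> k\<close> through its block \<open>1\<close>, the second is a
      function of \<open>y k\<close> itself.\<close>
    define h1 where "h1 = (\<lambda>v :: real^'n. - (\<alpha> * (Pt $ 1 $ 2 + Pt $ 2 $ 1)) *\<^sub>R (v - xs))"
    define h2 where "h2 = (\<lambda>v. - (2 * \<alpha> * Pt $ 1 $ 1) *\<^sub>R (v - xs - \<alpha> *\<^sub>R grad f v)
             + (c * (L * \<alpha>\<^sup>2 - \<alpha>)) *\<^sub>R grad f v)"
    have [measurable]: "grad f \<in> borel_measurable borel"
      by (rule borel_measurable_continuous_onI[OF smooth_strongly_convexD(3)[OF f]])
    have "has_bochner_integral M (\<lambda>\<omega>. w k \<omega> \<bullet> h1 (x (int k) \<omega>)) 0"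
    proof (rule indep_noise_cross_term[OF \<open>prob_space M\<close> ind\<xi> w0])
      show "(\<lambda>z. h1 (block 1 z)) \<in> borel_measurable borel"
        unfolding h1_def by measurable
      show "square_integrable M (\<lambda>\<omega>. h1 (x (int k) \<omega>))"
        using sq_x[of k] unfolding h1_def
        by (intro square_integrable_scaleR square_integrable_diff square_integrable_const fin) auto
      show "h1 (x (int k) \<omega>) = h1 (block 1 (\<xi> k \<omega>))" if "\<omega> \<in> space M" for \<omega>
        by (simp add: \<xi>_eq[OF that])
      show "h1 (x (int k) \<omega>) = h1 x0" if "\<omega> \<in> space M" "k = 0" for \<omega>
        using that init by simp
    qed
    moreover have "has_bochner_integral M (\<lambda>\<omega>. w k \<omega> \<bullet> h2 (y k \<omega>)) 0"
    proof (rule indep_noise_cross_term[OF \<open>prob_space M\<close> indy w0])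
      show "h2 \<in> borel_measurable borel"
        unfolding h2_def by measurable
      show "square_integrable M (\<lambda>\<omega>. h2 (y k \<omega>))"
        unfolding h2_def
        by (intro square_integrable_scaleR square_integrable_diff square_integrable_add
            square_integrable_const fin sq_grad sq_y)
      show "h2 (y k \<omega>) = h2 ((1 + \<beta>) *\<^sub>R x0 - \<beta> *\<^sub>R xm1)" if "\<omega> \<in> space M" "k = 0" for \<omega>
        using that init y_eq[of \<omega> 0] by simp
    qed simp
    moreover have "has_bochner_integral M (V k) (\<integral>\<omega>. V k \<omega> \<partial>M)"
      using V_int by (rule has_bochner_integral_integrable)
    ultimately have rhs: "has_bochner_integral M
        (\<lambda>\<omega>. \<rho>\<^sup>2 * V k \<omega> + w k \<omega> \<bullet> h1 (x (int k) \<omega>) + w k \<omega> \<bullet> h2 (y k \<omega>)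
          + \<alpha>\<^sup>2 * (Pt $ 1 $ 1 + c * L / 2) * (norm (w k \<omega>))\<^sup>2)
        (\<rho>\<^sup>2 * (\<integral>\<omega>. V k \<omega> \<partial>M) + 0 + 0 + N)"
      unfolding N_def by (intro has_bochner_integral_add has_bochner_integral_mult_right ww)
    have "(\<integral>\<omega>. V (Suc k) \<omega> \<partial>M) \<le> (\<integral>\<omega>. \<rho>\<^sup>2 * V k \<omega> + w k \<omega> \<bullet> h1 (x (int k) \<omega>) + w k \<omega> \<bullet> h2 (y k \<omega>)
          + \<alpha>\<^sup>2 * (Pt $ 1 $ 1 + c * L / 2) * (norm (w k \<omega>))\<^sup>2 \<partial>M)"
    proof (rule integral_mono[OF V_int])
      fix \<omega> assume \<omega>: "\<omega> \<in> space M"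
      have x_Suc: "x (int (Suc k)) \<omega> = y k \<omega> - \<alpha> *\<^sub>R (grad f (y k \<omega>) + w k \<omega>)"
        using x_step[OF \<omega>, of k] by (simp add: add.commute)
      have x_Suc': "x (int (Suc k) - 1) \<omega> = x (int k) \<omega>"
        by simp
      show "V (Suc k) \<omega> \<le> \<rho>\<^sup>2 * V k \<omega> + w k \<omega> \<bullet> h1 (x (int k) \<omega>) + w k \<omega> \<bullet> h2 (y k \<omega>)
          + \<alpha>\<^sup>2 * (Pt $ 1 $ 1 + c * L / 2) * (norm (w k \<omega>))\<^sup>2"
        unfolding V_def h1_def h2_def x_Suc x_Suc'
        using \<open>c\<^sub>0 \<ge> 0\<close> \<open>c > 0\<close> \<open>0 < \<rho>\<close> \<open>\<rho> < 1\<close>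
        by (intro Lyap_AG_step[OF f \<open>\<mu> \<le> L\<close> crit _ _ _ P assms(18)] y_eq[OF \<omega>]) auto
    qed (use rhs in \<open>simp add: has_bochner_integral_iff\<close>)
    also have "\<dots> = \<rho>\<^sup>2 * (\<integral>\<omega>. V k \<omega> \<partial>M) + N"
      using rhs by (simp add: has_bochner_integral_iff)
    finally show ?thesis .
  qed
  have "\<rho>\<^sup>2 < 1"
    using \<open>0 < \<rho>\<close> \<open>\<rho> < 1\<close> by (simp add: power_less_one_iff abs_square_less_1)
  define V0 where "V0 = Lyap f xs P c (stack (vector [x0, xm1]))"
  have V_init: "(\<integral>\<omega>. V 0 \<omega> \<partial>M) = V0"
  proof -
    have "(\<integral>\<omega>. V 0 \<omega> \<partial>M) = (\<integral>\<omega>. V0 \<partial>M)"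
      by (rule Bochner_Integration.integral_cong) (auto simp: V_def V0_def init)
    then show ?thesis by (simp add: prob_space)
  qed
  define s where "s = schur_11 Pt"
  have "0 \<le> s"
    unfolding s_def by (rule schur_11_nonneg) fact
  have "0 < c * L"
    using \<open>c > 0\<close> \<open>0 < L\<close> by simp
  then have D: "0 < c * L + 2 * s"
    using \<open>0 \<le> s\<close> by simp
  have subopt: "(c * L + 2 * s) * (f a - f xs) \<le> L * Lyap f xs P c (stack (vector [a, b]))" for a b
    unfolding s_def P by (rule suboptimality_le_Lyap[OF f crit \<open>psd Pt\<close> \<open>0 < L\<close>])
  \<comment> \<open>The sign of \<open>V0\<close> is what later permits enlarging its coefficient to
    \<open>1 / c\<close>.\<close>
  have "0 \<le> L * V0"
    unfolding V0_def using D min[of x0] by (intro order_trans[OF _ subopt]) simp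
  then have "0 \<le> V0"
    using \<open>0 < L\<close> by (simp add: zero_le_mult_iff)
  define R where "R = R_AG L CARD('n) \<rho> Pt c \<alpha>"
  \<comment> \<open>The fixed point of the recursion, converted from Lyapunov value to
    suboptimality, is exactly the claimed noise level.\<close>
  have R: "L / (c * L + 2 * s) * (N / (1 - \<rho>\<^sup>2)) = \<sigma>\<^sup>2 * R"
    unfolding R_def R_AG_schur_11[OF \<open>psd Pt\<close> \<open>0 < c * L\<close>] s_def[symmetric] N_def
    using D \<open>\<rho>\<^sup>2 < 1\<close> by (simp add: field_simps)
  have bound: "(\<integral>\<omega>. f (x (int k) \<omega>) - f xs \<partial>M) \<le>
      \<rho> ^ (2 * k) * (1 / c * V0) + (1 - \<rho> ^ (2 * k)) * (\<sigma>\<^sup>2 * R)" for k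
  proof -
    have "(\<integral>\<omega>. f (x (int k) \<omega>) - f xs \<partial>M) \<le> (\<integral>\<omega>. L / (c * L + 2 * s) * V k \<omega> \<partial>M)"
    proof (intro integral_mono f_int integrable_mult_right V_int)
      fix \<omega>
      show "f (x (int k) \<omega>) - f xs \<le> L / (c * L + 2 * s) * V k \<omega>"
        unfolding V_def times_divide_eq_left pos_le_divide_eq[OF D]
        using subopt[of "x (int k) \<omega>"] by (simp only: mult.commute)
    qed
    also have "\<dots> = L / (c * L + 2 * s) * (\<integral>\<omega>. V k \<omega> \<partial>M)"
      by simp
    also have "\<dots> \<le> L / (c * L + 2 * s) * ((\<rho>\<^sup>2) ^ k * V0 + (1 - (\<rho>\<^sup>2) ^ k) * (N / (1 - \<rho>\<^sup>2)))"
      using D \<open>0 < L\<close> \<open>\<rho>\<^sup>2 < 1\<close> V_step V_init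
        affine_recursion_bound[of "\<rho>\<^sup>2" "\<lambda>k. \<integral>\<omega>. V k \<omega> \<partial>M" N k]
      by (intro mult_left_mono) auto
    also have "\<dots> = \<rho> ^ (2 * k) * (L / (c * L + 2 * s) * V0) + (1 - \<rho> ^ (2 * k)) * (\<sigma>\<^sup>2 * R)"
      unfolding R[symmetric] power_mult by (simp add: distrib_left mult_ac)
    \<comment> \<open>Only the initial term is relaxed, by dropping \<open>2 * s\<close>; the noise
      term keeps the sharper factor.\<close>
    also have "\<dots> \<le> \<rho> ^ (2 * k) * (1 / c * V0) + (1 - \<rho> ^ (2 * k)) * (\<sigma>\<^sup>2 * R)"
    proof -
      have "L / (c * L + 2 * s) \<le> 1 / c"
        using frac_le[of L L "c * L" "c * L + 2 * s"] \<open>0 < L\<close> \<open>0 < c * L\<close> \<open>0 \<le> s\<close> by simp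
      then have "L / (c * L + 2 * s) * V0 \<le> 1 / c * V0"
        using \<open>0 \<le> V0\<close> by (rule mult_right_mono)
      then show ?thesis
        using \<open>0 < \<rho>\<close> by (simp only: add_le_cancel_right mult_le_cancel_left_pos zero_less_power)
    qed
    finally show ?thesis .
  qed
  \<comment> \<open>The right side of \<open>bound\<close> converges, so its limsup is its limit;
    the initial term dies out with \<open>\<rho> ^ (2 * k)\<close>.\<close>
  have "limsup (\<lambda>k. ereal (1 / \<sigma>\<^sup>2 * (\<integral>\<omega>. f (x (int k) \<omega>) - f xs \<partial>M)))
      \<le> limsup (\<lambda>k. ereal (1 / \<sigma>\<^sup>2 * (\<rho> ^ (2 * k) * (1 / c * V0) + (1 - \<rho> ^ (2 * k)) * (\<sigma>\<^sup>2 * R))))"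
    using bound by (intro Limsup_mono always_eventually allI ereal_less_eq(3)[THEN iffD2] mult_left_mono) auto
  also have "\<dots> = ereal R"
  proof (intro lim_imp_Limsup tendsto_ereal sequentially_bot)
    have "(\<lambda>k. \<rho> ^ (2 * k)) \<longlonglongrightarrow> 0"
      using \<open>\<rho>\<^sup>2 < 1\<close> unfolding power_mult by (intro LIMSEQ_realpow_zero) auto
    then have "(\<lambda>k. 1 / \<sigma>\<^sup>2 * (\<rho> ^ (2 * k) * (1 / c * V0) + (1 - \<rho> ^ (2 * k)) * (\<sigma>\<^sup>2 * R)))
        \<longlonglongrightarrow> 1 / \<sigma>\<^sup>2 * (0 * (1 / c * V0) + (1 - 0) * (\<sigma>\<^sup>2 * R))"
      by (intro tendsto_intros)
    then show "(\<lambda>k. 1 / \<sigma>\<^sup>2 * (\<rho> ^ (2 * k) * (1 / c * V0) + (1 - \<rho> ^ (2 * k)) * (\<sigma>\<^sup>2 * R))) \<longlonglongrightarrow> R"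
      using \<sigma> by simp
  qed
  finally show ?thesis
    using f_int bound unfolding V0_def R_def by blast
qed

end
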